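(* Let $p\geq 5$ be a prime and let $(k,|\cdot|)$ be an ultrametric field of characteristic $p$. Let $f$ be a power series with coefficients in the closed unit disk $\{a\in k: |a|\le 1\}$ of $k$, of the form $$f(\zeta)=\zeta\left(1+\sum_{j=2}^{+\infty}a_j\zeta^j\right).$$ Put $\lambda := a_2^{p-3}\left(\tfrac{3}{2}a_2^3+a_3^2-a_2a_4\right)$. Let $\zeta_0$ be a periodic point of $f$ in the open unit disk $\{\zeta\in k:|\zeta|<1\}$ of $k$. If $\zeta_0$ is not a fixed point of $f$, then $$|\zeta_0|\geq|\lambda|^{\frac1p}.$$ If $\zeta_0\neq 0$ is a fixed point of $f$, then $|\zeta_0|\geq|a_2|$.
   Context: An ultrametric field $(k,|\cdot|)$ is a field with a non-Archimedean absolute value. For $\zeta$ in the open unit disk, $f(\zeta)$ denotes the value of the (convergent) power series at $\zeta$. A periodic point of $f$ is a point $\zeta_0$ with $f^m(\zeta_0)=\zeta_0$ for some integer $m\ge1$, where $f^m$ is the $m$-fold composition of $f$ with itself; it is a fixed point if $f(\zeta_0)=\zeta_0$. *)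

theory Defs
  imports Complex_Main "HOL-Computational_Algebra.Computational_Algebra"
begin

locale ultrametric_field =
  fixes absv :: "'a::field \<Rightarrow> real"
  assumes absv_nonneg: "0 \<le> absv x"
    and absv_eq_0_iff: "absv x = 0 \<longleftrightarrow> x = 0"
    and absv_mult: "absv (x * y) = absv x * absv y"
    and absv_add_le_max: "absv (x + y) \<le> max (absv x) (absv y)"

definition fps_has_value :: "('a::field \<Rightarrow> real) \<Rightarrow> 'a fps \<Rightarrow> 'a \<Rightarrow> 'a \<Rightarrow> bool" where
  "fps_has_value absv f z s \<longleftrightarrow>
     (\<lambda>n. absv ((\<Sum>i<n. fps_nth f i * z ^ i) - s)) \<longlonglongrightarrow> 0"

definition fps_converges_at :: "('a::field \<Rightarrow> real) \<Rightarrow> 'a fps \<Rightarrow> 'a \<Rightarrow> bool" where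
  "fps_converges_at absv f z \<longleftrightarrow> (\<exists>s. fps_has_value absv f z s)"

definition fps_value :: "('a::field \<Rightarrow> real) \<Rightarrow> 'a fps \<Rightarrow> 'a \<Rightarrow> 'a" where
  "fps_value absv f z = (THE s. fps_has_value absv f z s)"

(* The field is not assumed complete, so convergence of the series at every point
   of the orbit is part of the notion of a periodic point. In a complete field it
   is automatic for series with coefficients in the closed unit disk and points in
   the open unit disk. *)
definition fps_fixed_point :: "('a::field \<Rightarrow> real) \<Rightarrow> 'a fps \<Rightarrow> 'a \<Rightarrow> bool" where
  "fps_fixed_point absv f z \<longleftrightarrow> fps_converges_at absv f z \<and> fps_value absv f z = z"

definition fps_periodic_point :: "('a::field \<Rightarrow> real) \<Rightarrow> 'a fps \<Rightarrow> 'a \<Rightarrow> bool" where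
  "fps_periodic_point absv f z \<longleftrightarrow>
     (\<exists>m\<ge>1. (\<forall>i<m. fps_converges_at absv f ((fps_value absv f ^^ i) z)) \<and>
             (fps_value absv f ^^ m) z = z)"

context ultrametric_field
begin

lemma absv_uminus: "absv (- x) = absv x"
proof -
  have "absv 1 = absv 1 * absv 1" using absv_mult[of 1 1] by simp
  moreover have "absv 1 \<noteq> 0" by (simp add: absv_eq_0_iff)
  ultimately have "absv 1 = 1" by simp
  then have "absv (- 1) * absv (- 1) = 1" using absv_mult[of "- 1" "- 1"] by simp
  then have "absv (- 1) = 1"
    using absv_nonneg[of "- 1"] by (metis abs_of_nonneg power2_eq_square power2_eq_1_iff abs_1 abs_minus_cancel)
  then show ?thesis using absv_mult[of "- 1" x] by simp
qed

lemma fps_has_value_unique: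
  assumes "fps_has_value absv f z s" "fps_has_value absv f z t"
  shows "s = t"
proof -
  let ?S = "\<lambda>n. \<Sum>i<n. fps_nth f i * z ^ i"
  have "(\<lambda>n. max (absv (?S n - s)) (absv (?S n - t))) \<longlonglongrightarrow> max 0 0"
    using assms unfolding fps_has_value_def by (intro tendsto_max)
  moreover have "absv (s - t) \<le> max (absv (?S n - s)) (absv (?S n - t))" for n
    using absv_add_le_max[of "- (?S n - s)" "?S n - t"] absv_uminus[of "?S n - s"] by simp
  ultimately have "absv (s - t) \<le> 0"
    by (intro LIMSEQ_le_const[of _ "0"]) auto
  then show ?thesis
    using absv_nonneg[of "s - t"] absv_eq_0_iff[of "s - t"] by simp
qed

lemma fps_value_eqI: "fps_has_value absv f z s \<Longrightarrow> fps_value absv f z = s"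
  unfolding fps_value_def using fps_has_value_unique by blast

end

end

theory Submission imports Defs "HOL-Number_Theory.Residues" begin

text \<open>
  Let \<open>F = f\<^sup>N\<close> and \<open>G = f\<^sup>M\<close> be the iterates of \<open>f\<close> with \<open>N = p\<^sup>n\<^sup>+\<^sup>1\<close> and \<open>M = p\<^sup>n\<close>. The proof
  compares two descriptions of the quotient \<open>h = (F - X) / (G - X)\<close>, which is a power
  series with coefficients in the closed unit disk.

  On the one hand, let \<open>z\<close> be a periodic point that is not fixed. Because \<open>f\<close> is tangent to the
  identity, a factor of the period that is prime to \<open>p\<close> cannot occur
  (\<open>minimal_period_prime_power\<close>), so the minimal period of \<open>z\<close> is some
  \<open>N\<close> as above. All \<open>N\<close> points of the orbit of \<open>z\<close> are zeros of \<open>h\<close>, of absolute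
  value at most \<open>|z|\<close>. Splitting off one linear factor \<open>X - x\<close> for each of them leaves a
  quotient with coefficients in the closed unit disk, hence the lowest nonzero coefficient of
  \<open>h\<close> has absolute value at most \<open>|z|\<^sup>N\<close> (\<open>lowest_coefficient_le_prod_roots\<close>). The field is not
  assumed to be complete, so all series are evaluated only at points where their convergence is known.

  On the other hand, if \<open>\<lambda> \<noteq> 0\<close> then that lowest coefficient is \<open>\<lambda>\<^sup>M\<close>, which gives
  \<open>|\<lambda>| \<le> |z|\<^sup>p\<close>. This is \<open>prime_power_iterate_leading_coefficient\<close>, and it rests on two ideas.
  First, in characteristic \<open>p\<close> the difference operator \<open>\<phi> \<mapsto> \<phi> \<circ> g - \<phi>\<close>, applied
  \<open>p\<close> times, is the difference operator of the iterate \<open>g\<^sup>p\<close>. If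
  \<open>g = X + X\<^sup>d (A X + B X\<^sup>2 + C X\<^sup>3 + \<dots>)\<close> with \<open>d\<close> congruent to \<open>2\<close> modulo \<open>p\<close>, the three
  lowest coefficients of its powers satisfy a linear recursion that can be solved in closed form; the
  first two vanish at the \<open>p\<close>-th step, and the third one is evaluated by Wilson's theorem
  (\<open>prime_iterate_leading_coefficient\<close>). Second, the next iterate needs \<open>B\<close> and \<open>C\<close> of the
  present one. They come for free: an iterate of \<open>f\<close> commutes with \<open>f\<close>, and this
  determines \<open>B / A\<close> and \<open>C / A\<close> from the coefficients of \<open>f\<close>
  (\<open>commuting_series_coefficients\<close>).

  For a fixed point \<open>z \<noteq> 0\<close> the same estimate is applied to the single zero \<open>z\<close> of
  \<open>f - X = a\<^sub>2 X\<^sup>3 + \<dots>\<close>.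
\<close>

section \<open>Iterates and differences of series tangent to the identity\<close>

primrec fps_iterate :: "'a::comm_ring_1 fps \<Rightarrow> nat \<Rightarrow> 'a fps" where
  "fps_iterate f 0 = fps_X"
| "fps_iterate f (Suc n) = fps_iterate f n oo f"

lemma fps_iterate_nth_0:
  assumes "f $ 0 = 0"
  shows "fps_iterate f n $ 0 = 0"
  using assms by (induction n) auto

lemma fps_iterate_add:
  fixes f :: "'a::idom fps"
  assumes "f $ 0 = 0"
  shows "fps_iterate f (m + n) = fps_iterate f m oo fps_iterate f n"
proof (induction n)
  case (Suc n)
  then show ?case
    using fps_compose_assoc[of f "fps_iterate f n" "fps_iterate f m"] fps_iterate_nth_0[OF assms] assms
    by simp
qed simp

lemma fps_iterate_mult:
  fixes f :: "'a::idom fps"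
  assumes "f $ 0 = 0"
  shows "fps_iterate f (n * m) = fps_iterate (fps_iterate f n) m"
proof (induction m)
  case (Suc m)
  have "fps_iterate f (n * Suc m) = fps_iterate f (n * m + n)" by (simp add: add.commute)
  then show ?case using Suc fps_iterate_add[OF assms] by simp
qed simp

text \<open>
  Equivalently, \<open>g = X + O(X\<^sup>d\<^sup>+\<^sup>1)\<close>; there is no condition on the coefficient of \<open>X\<^sup>d\<^sup>+\<^sup>1\<close>,
  so that tangency of a higher order is included.
\<close>

definition tangent_to_id :: "nat \<Rightarrow> 'a::comm_ring_1 fps \<Rightarrow> bool" where
  "tangent_to_id d g \<longleftrightarrow> (\<forall>k\<le>d. g $ k = fps_X $ k)"

lemma tangent_to_id_nth_0: "tangent_to_id d g \<Longrightarrow> g $ 0 = 0"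
  by (simp add: tangent_to_id_def)

lemma one_plus_power_quadratic:
  fixes y :: "'a::comm_ring_1"
  shows "\<exists>r. (1 + y) ^ i = 1 + of_nat i * y + of_nat (i choose 2) * y ^ 2 + y ^ 3 * r"
proof (induction i)
  case 0
  then show ?case by (intro exI[of _ 0]) (simp add: numeral_2_eq_2)
next
  case (Suc i)
  then obtain r where r: "(1 + y) ^ i = 1 + of_nat i * y + of_nat (i choose 2) * y ^ 2 + y ^ 3 * r"
    by blast
  have "Suc i choose 2 = i + (i choose 2)" by (simp add: numeral_2_eq_2)
  then show ?case
    by (intro exI[of _ "of_nat (i choose 2) + r * (1 + y)"])
      (simp add: r algebra_simps power2_eq_square power3_eq_cube)
qed

lemma tangent_power_factor:
  fixes g :: "'a::comm_ring_1 fps"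
  assumes "tangent_to_id d g" "d \<ge> 1"
  shows "g ^ i = fps_X ^ i * (1 + fps_X ^ d * fps_shift (Suc d) g) ^ i"
proof -
  have "g = fps_X * (1 + fps_X ^ d * fps_shift (Suc d) g)"
  proof (rule fps_ext)
    fix n
    show "g $ n = (fps_X * (1 + fps_X ^ d * fps_shift (Suc d) g)) $ n"
    proof (cases n)
      case 0
      then show ?thesis using tangent_to_id_nth_0[OF assms(1)] by simp
    next
      case (Suc m)
      have "g $ Suc m = (if m = 0 then 1 else 0)" if "m < d"
        using assms that by (auto simp: tangent_to_id_def)
      then show ?thesis using Suc assms(2) by (auto simp: fps_X_power_mult_nth)
    qed
  qed
  then show ?thesis using power_mult_distrib by metis
qed

text \<open>
  Writing \<open>g = X (1 + X\<^sup>d W)\<close>, the binomial expansion of \<open>g\<^sup>i\<close> involves the powers of \<open>X\<^sup>d W\<close>.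
  For \<open>d \<ge> 2\<close> its cube does not reach the three coefficients that follow the gap, and its
  square reaches only the last of them, and only if \<open>d = 2\<close>. This is where the term
  \<open>3/2 a\<^sub>2\<^sup>3\<close> of \<open>\<lambda>\<close> originates.
\<close>

lemma tangent_power_nth:
  fixes g :: "'a::comm_ring_1 fps"
  assumes "tangent_to_id d g" "d \<ge> 1"
  shows "k < i + d \<Longrightarrow> (g ^ i) $ k = (if k = i then 1 else 0)"
    and "(g ^ i) $ (i + d) = of_nat i * g $ (d + 1)"
    and "d \<ge> 2 \<Longrightarrow> (g ^ i) $ (i + d + 1) = of_nat i * g $ (d + 2)"
    and "d \<ge> 2 \<Longrightarrow> (g ^ i) $ (i + d + 2) =
           of_nat i * g $ (d + 3) + (if d = 2 then of_nat (i choose 2) * (g $ (d + 1)) ^ 2 else 0)"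
proof -
  let ?W = "fps_shift (Suc d) g"
  obtain r where r: "(1 + fps_X ^ d * ?W) ^ i = 1 + of_nat i * (fps_X ^ d * ?W)
      + of_nat (i choose 2) * (fps_X ^ d * ?W) ^ 2 + (fps_X ^ d * ?W) ^ 3 * r"
    using one_plus_power_quadratic by blast
  define U where "U = 1 + fps_X ^ d * (of_nat i * ?W) + fps_X ^ (2 * d) * (of_nat (i choose 2) * ?W ^ 2)
      + fps_X ^ (3 * d) * (?W ^ 3 * r)"
  have "(1 + fps_X ^ d * ?W) ^ i = U"
    unfolding r U_def power_mult_distrib power_mult[symmetric] by (simp add: algebra_simps)
  then have gi: "g ^ i = fps_X ^ i * U" using tangent_power_factor[OF assms] by metis
  have ofn: "(of_nat n * F) $ j = of_nat n * (F $ j)" for n j and F :: "'a fps"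
    by (metis fps_mult_left_const_nth fps_of_nat)
  show "(g ^ i) $ k = (if k = i then 1 else 0)" if "k < i + d"
    using that assms(2) by (auto simp: gi fps_X_power_mult_nth U_def)
  show "(g ^ i) $ (i + d) = of_nat i * g $ (d + 1)"
    using assms(2) by (auto simp: gi fps_X_power_mult_nth U_def ofn)
  show "(g ^ i) $ (i + d + 1) = of_nat i * g $ (d + 2)" if "d \<ge> 2"
    using that by (auto simp: gi fps_X_power_mult_nth U_def ofn)
  show "(g ^ i) $ (i + d + 2) =
      of_nat i * g $ (d + 3) + (if d = 2 then of_nat (i choose 2) * (g $ (d + 1)) ^ 2 else 0)"
    if "d \<ge> 2"
  proof (cases "d = 2")
    case True
    then show ?thesis by (simp add: gi fps_X_power_mult_nth U_def ofn fps_power_zeroth)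
  next
    case False
    then have "d + 2 < 2 * d" "d + 2 < 3 * d" using that by auto
    then show ?thesis using that False by (simp add: gi fps_X_power_mult_nth U_def ofn eval_nat_numeral)
  qed
qed

definition fps_difference :: "'a::comm_ring_1 fps \<Rightarrow> 'a fps \<Rightarrow> 'a fps" where
  "fps_difference g \<phi> = (\<phi> oo g) - \<phi>"

lemma fps_difference_nth:
  fixes g :: "'a::comm_ring_1 fps"
  assumes "tangent_to_id d g" "d \<ge> 1"
  shows "k < d \<Longrightarrow> fps_difference g \<phi> $ k = 0"
    and "fps_difference g \<phi> $ (k + d) = (\<Sum>i\<le>k. \<phi> $ i * (g ^ i) $ (k + d))"
proof -
  have comp: "(\<phi> oo g) $ n = (\<Sum>i\<in>{0..n}. \<phi> $ i * (g ^ i) $ n)" for n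
    by (simp add: fps_compose_nth)
  have less: "(g ^ i) $ n = (if n = i then 1 else 0)" if "n < i + d" for i n
    using tangent_power_nth(1)[OF assms that] .
  show "fps_difference g \<phi> $ k = 0" if "k < d"
    using that by (simp add: fps_difference_def comp less if_distrib sum.delta cong: if_cong)
  have "(\<Sum>i\<in>{0..k+d}. \<phi> $ i * (g ^ i) $ (k + d)) =
      (\<Sum>i\<in>{0..k}. \<phi> $ i * (g ^ i) $ (k + d)) + (\<Sum>i\<in>{k+1..k+d}. \<phi> $ i * (g ^ i) $ (k + d))"
    by (rule sum.ub_add_nat) simp
  also have "(\<Sum>i\<in>{k+1..k+d}. \<phi> $ i * (g ^ i) $ (k + d)) = (\<Sum>i\<in>{k+1..k+d}. if k + d = i then \<phi> $ i else 0)"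
    by (rule sum.cong) (auto simp: less)
  also have "\<dots> = \<phi> $ (k + d)" using assms(2) by (simp add: sum.delta)
  finally show "fps_difference g \<phi> $ (k + d) = (\<Sum>i\<le>k. \<phi> $ i * (g ^ i) $ (k + d))"
    by (simp add: fps_difference_def comp atMost_atLeast0)
qed

text \<open>
  To first order \<open>\<phi> \<circ> g - \<phi>\<close> is \<open>(g - X) \<phi>'\<close>: a monomial \<open>X\<^sup>s\<close> is moved up by \<open>d\<close> and multiplied
  by \<open>s\<close>. Three consecutive coefficients are recorded because, in characteristic \<open>p\<close>, the
  factor \<open>s\<close> vanishes once for each of the first two of them before the \<open>p\<close>-th application.
\<close>

lemma fps_difference_leading_coefficients:
  fixes g :: "'a::comm_ring_1 fps"
  assumes "tangent_to_id d g" "d \<ge> 2" and low: "\<forall>k<s. \<phi> $ k = 0"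
  shows "k < s + d \<Longrightarrow> fps_difference g \<phi> $ k = 0"
    and "fps_difference g \<phi> $ (s + d) = of_nat s * \<phi> $ s * g $ (d + 1)"
    and "fps_difference g \<phi> $ (s + d + 1) =
           of_nat (s + 1) * \<phi> $ (s + 1) * g $ (d + 1) + of_nat s * \<phi> $ s * g $ (d + 2)"
    and "fps_difference g \<phi> $ (s + d + 2) =
           of_nat (s + 2) * \<phi> $ (s + 2) * g $ (d + 1) + of_nat (s + 1) * \<phi> $ (s + 1) * g $ (d + 2)
           + of_nat s * \<phi> $ s * g $ (d + 3)
           + (if d = 2 then of_nat (s choose 2) * \<phi> $ s * (g $ (d + 1)) ^ 2 else 0)"
proof -
  have d1: "d \<ge> 1" using assms(2) by simp
  note diff = fps_difference_nth[OF assms(1) d1] and pow = tangent_power_nth[OF assms(1) d1]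
  have expand: "fps_difference g \<phi> $ (s + j + d) = (\<Sum>i\<le>j. \<phi> $ (s + i) * (g ^ (s + i)) $ (s + j + d))" for j
  proof -
    have "fps_difference g \<phi> $ (s + j + d) = (\<Sum>i\<in>{s..s+j}. \<phi> $ i * (g ^ i) $ (s + j + d))"
      unfolding diff(2) by (rule sum.mono_neutral_right) (auto simp: low)
    also have "\<dots> = (\<Sum>i\<in>{0..j}. \<phi> $ (i + s) * (g ^ (i + s)) $ (s + j + d))"
      using sum.shift_bounds_cl_nat_ivl[of "\<lambda>i. \<phi> $ i * (g ^ i) $ (s + j + d)" 0 s j] by (simp add: add.commute)
    finally show ?thesis by (simp add: atMost_atLeast0 add.commute)
  qed
  show "fps_difference g \<phi> $ k = 0" if "k < s + d"
  proof (cases "k < d")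
    case False
    then have split: "k = (k - d) + d" and "k - d < s" using that by auto
    then show ?thesis by (subst split, subst diff(2), intro sum.neutral) (auto simp: low)
  qed (rule diff(1))
  show "fps_difference g \<phi> $ (s + d) = of_nat s * \<phi> $ s * g $ (d + 1)"
    using expand[of 0] pow(2)[of s] by (simp add: algebra_simps)
  show "fps_difference g \<phi> $ (s + d + 1) =
      of_nat (s + 1) * \<phi> $ (s + 1) * g $ (d + 1) + of_nat s * \<phi> $ s * g $ (d + 2)"
    using expand[of 1] pow(3)[of s, OF assms(2)] pow(2)[of "s + 1"] by (simp add: algebra_simps)
  have "{..2::nat} = {0,1,2}" by auto
  then show "fps_difference g \<phi> $ (s + d + 2) =
      of_nat (s + 2) * \<phi> $ (s + 2) * g $ (d + 1) + of_nat (s + 1) * \<phi> $ (s + 1) * g $ (d + 2)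
      + of_nat s * \<phi> $ s * g $ (d + 3)
      + (if d = 2 then of_nat (s choose 2) * \<phi> $ s * (g $ (d + 1)) ^ 2 else 0)"
    using expand[of 2] pow(4)[of s, OF assms(2)] pow(3)[of "s + 1", OF assms(2)] pow(2)[of "s + 2"]
    by (simp add: algebra_simps)
qed

text \<open>
  Newton's forward difference formula. With the operator \<open>T \<phi> = \<phi> \<circ> g\<close> it is the expansion
  of \<open>T\<^sup>n = (1 + (T - 1))\<^sup>n\<close>.
\<close>

lemma fps_compose_iterate_newton:
  fixes g :: "'a::idom fps"
  assumes "g $ 0 = 0"
  shows "\<phi> oo fps_iterate g n = (\<Sum>k\<le>n. of_nat (n choose k) * (fps_difference g ^^ k) \<phi>)"
proof (induction n)
  case (Suc n)
  let ?y = "\<lambda>k. (fps_difference g ^^ k) \<phi>"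
  have step: "?y k oo g = ?y k + ?y (Suc k)" for k by (simp add: fps_difference_def)
  have "\<phi> oo fps_iterate g (Suc n) = (\<phi> oo fps_iterate g n) oo g"
    using fps_compose_assoc[of g "fps_iterate g n" \<phi>] assms fps_iterate_nth_0[OF assms] by simp
  also have "\<dots> = (\<Sum>k\<le>n. of_nat (n choose k) * (?y k + ?y (Suc k)))"
    unfolding Suc fps_compose_sum_distrib
    by (rule sum.cong) (simp_all only: fps_compose_mult_distrib[OF assms] step fps_of_nat[symmetric] fps_const_compose)
  also have "\<dots> = (\<Sum>k\<le>n. of_nat (n choose k) * ?y k) + (\<Sum>k\<le>n. of_nat (n choose k) * ?y (Suc k))"
    by (simp add: distrib_left sum.distrib)
  also have "(\<Sum>k\<le>n. of_nat (n choose k) * ?y k) = ?y 0 + (\<Sum>k\<le>n. of_nat (n choose Suc k) * ?y (Suc k))"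
    using sum.atMost_Suc_shift[of "\<lambda>k. of_nat (n choose k) * ?y k" n]
    by (simp add: sum.atMost_Suc binomial_eq_0)
  also have "?y 0 + (\<Sum>k\<le>n. of_nat (n choose Suc k) * ?y (Suc k)) + (\<Sum>k\<le>n. of_nat (n choose k) * ?y (Suc k))
      = (\<Sum>k\<le>Suc n. of_nat (Suc n choose k) * ?y k)"
    unfolding sum.atMost_Suc_shift by (simp add: sum.distrib[symmetric] distrib_right algebra_simps)
  finally show ?case .
qed simp

text \<open>
  All binomial coefficients in Newton's formula except the outer two are divisible by \<open>p\<close>; this is
  \<open>T\<^sup>p - 1 = (T - 1)\<^sup>p\<close> for composition operators.
\<close>

lemma fps_difference_iterate_prime:
  fixes g :: "'a::idom fps"
  assumes "prime p" "CHAR('a) = p" "g $ 0 = 0"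
  shows "fps_difference (fps_iterate g p) \<phi> = (fps_difference g ^^ p) \<phi>"
proof -
  have zero: "(of_nat (p choose k) :: 'a fps) = 0" if "0 < k" "k < p" for k
    using dvd_choose_prime[of k p] that assms(1,2) by (simp add: of_nat_eq_0_iff_char_dvd)
  have "\<phi> oo fps_iterate g p = (\<Sum>k\<in>{0, p}. of_nat (p choose k) * (fps_difference g ^^ k) \<phi>)"
    unfolding fps_compose_iterate_newton[OF assms(3)]
    by (rule sum.mono_neutral_right) (auto simp: zero)
  then show ?thesis using assms(1) by (simp add: fps_difference_def prime_gt_0_nat)
qed

section \<open>Leading coefficients of the iterates of order a power of the characteristic\<close>

definition odd_factorial :: "nat \<Rightarrow> nat" where
  "odd_factorial m = (\<Prod>i<m. 2 * i + 1)"

lemma odd_factorial_Suc: "odd_factorial (Suc m) = (2 * m + 1) * odd_factorial m"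
  by (simp add: odd_factorial_def)

text \<open>
  The solution of the recursion is \<open>(2m + 1)!! (1/3 + 1/5 + \<dots> + 1/(2m + 1))\<close>. The
  recursive form keeps it free of denominators, which vanish in characteristic \<open>p\<close>.
\<close>

primrec odd_reciprocal_sum :: "nat \<Rightarrow> nat" where
  "odd_reciprocal_sum 0 = 0"
| "odd_reciprocal_sum (Suc m) = (2 * m + 3) * odd_reciprocal_sum m + odd_factorial (Suc m)"

lemma odd_factorial_mult_even_factorial:
  "odd_factorial h * (\<Prod>i<h. 2 * i + 2) = fact (2 * h)"
proof (induction h)
  case (Suc h)
  have "odd_factorial (Suc h) * (\<Prod>i<Suc h. 2 * i + 2) =
      (odd_factorial h * (\<Prod>i<h. 2 * i + 2)) * ((2 * h + 1) * (2 * h + 2))"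
    unfolding odd_factorial_Suc prod.lessThan_Suc by (simp only: mult_ac)
  then show ?case unfolding Suc by (simp add: algebra_simps)
qed (simp add: odd_factorial_def)

context
  fixes p h :: nat
  assumes prime: "prime p" and p_eq: "p = 2 * h + 1" and h_pos: "h > 0"
    and char: "CHAR('a::comm_ring_1) = p"
begin

lemma of_nat_char: "of_nat (2 * h + 1) = (0::'a)"
  using char p_eq of_nat_CHAR by metis

lemma of_nat_odd_factorial_eq_0:
  assumes "m > h"
  shows "of_nat (odd_factorial m) = (0::'a)"
proof -
  have "2 * h + 1 dvd odd_factorial m"
    unfolding odd_factorial_def using assms by (intro dvd_prodI[of _ h "\<lambda>i. 2 * i + 1"]) auto
  then show ?thesis using of_nat_char by (metis dvdE mult_zero_left of_nat_mult)
qed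

text \<open>
  The only summand of \<open>(2p + 1)!! (1/3 + \<dots> + 1/(2p + 1))\<close> that is not divisible by \<open>p\<close> is
  the one whose denominator \<open>p\<close> cancels the factor \<open>p\<close> of the double factorial. What remains is the product of
  the odd numbers below \<open>p\<close> and of the numbers \<open>p + 2, p + 4, \<dots>, 2p + 1\<close>, that is \<open>(p - 1)!\<close>
  modulo \<open>p\<close>, and Wilson's theorem applies.
\<close>

lemma of_nat_odd_reciprocal_sum_prime: "of_nat (odd_reciprocal_sum p) = (-1::'a)"
proof -
  \<comment> \<open>Modulo \<open>p = 2h + 1\<close> the step from \<open>h - 1\<close> to \<open>h\<close> forgets the past, and later steps only multiply.\<close>
  have tail: "of_nat (odd_reciprocal_sum (h + j)) = (of_nat (odd_factorial h * (\<Prod>i<j. 2 * i + 2)) :: 'a)" for j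
  proof (induction j)
    case 0
    obtain k where k: "h = Suc k" using h_pos by (cases h) auto
    have "2 * k + 3 = 2 * h + 1" using k by simp
    then have "of_nat (odd_reciprocal_sum h) = of_nat (2 * h + 1) * of_nat (odd_reciprocal_sum k) + (of_nat (odd_factorial h) :: 'a)"
      using k by (metis odd_reciprocal_sum.simps(2) of_nat_add of_nat_mult)
    then show ?case using of_nat_char by simp
  next
    case (Suc j)
    have "odd_reciprocal_sum (h + Suc j) =
        (2 * h + 1) * odd_reciprocal_sum (h + j) + (2 * j + 2) * odd_reciprocal_sum (h + j) + odd_factorial (h + Suc j)"
      by (simp add: algebra_simps)
    then have "(of_nat (odd_reciprocal_sum (h + Suc j)) :: 'a) = of_nat (2 * h + 1) * of_nat (odd_reciprocal_sum (h + j))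
        + of_nat (2 * j + 2) * of_nat (odd_reciprocal_sum (h + j)) + of_nat (odd_factorial (h + Suc j))"
      by (metis of_nat_add of_nat_mult)
    also have "\<dots> = of_nat (2 * j + 2) * of_nat (odd_reciprocal_sum (h + j))"
      using of_nat_char of_nat_odd_factorial_eq_0[of "h + Suc j"] by simp
    finally show ?case unfolding Suc prod.lessThan_Suc of_nat_mult by (simp only: mult_ac)
  qed
  have last: "of_nat (2 * h + 2) = (1::'a)"
    using of_nat_char of_nat_add[of "2 * h + 1" 1, where 'a = 'a] by simp
  have "p = h + Suc h" using p_eq by simp
  then have "(of_nat (odd_reciprocal_sum p) :: 'a) = of_nat (odd_factorial h * (\<Prod>i<h. 2 * i + 2) * (2 * h + 2))"
    using tail[of "Suc h"] unfolding prod.lessThan_Suc by (simp only: mult.assoc)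
  also have "\<dots> = of_nat (fact (p - 1))"
    unfolding odd_factorial_mult_even_factorial of_nat_mult last using p_eq by simp
  finally have E: "(of_nat (odd_reciprocal_sum p) :: 'a) = of_nat (fact (p - 1))" .
  have "int p dvd int (fact (p - 1) + 1)"
    using wilson_theorem[OF prime] by (simp add: cong_iff_dvd_diff add.commute)
  then have "p dvd fact (p - 1) + 1" by (simp only: int_dvd_int_iff)
  then have "of_nat (fact (p - 1) + 1) = (0::'a)" using char of_nat_eq_0_iff_char_dvd by metis
  then show ?thesis unfolding E by (simp add: eq_neg_iff_add_eq_0 add.commute)
qed

end

text \<open>
  The exponent \<open>s = 1 + m d\<close> reached after \<open>m\<close> steps is \<open>2m + 1\<close> in the field, so the lowest
  coefficient picks up the odd double factorial. The initial series is not \<open>X\<close> but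
  \<open>A\<^sup>2 X + A B X\<^sup>2\<close>: the second term selects the solution of the recursion for which
  the second coefficient stays \<open>(2m + 1) B / A\<close> times the first one, and the factor \<open>A\<^sup>2\<close> avoids
  denominators. The third coefficient is then found by variation of constants.
\<close>

lemma fps_difference_power_coefficients:
  fixes g :: "'a::field fps"
  assumes tang: "tangent_to_id d g" and d: "d \<ge> 2" and d_char: "of_nat d = (2::'a)" and two: "(2::'a) \<noteq> 0"
  defines "A \<equiv> g $ (d + 1)" and "B \<equiv> g $ (d + 2)" and "C \<equiv> g $ (d + 3)"
  defines "e \<equiv> (if d = 2 then 1 else 0 :: 'a)"
  defines "\<phi> \<equiv> fps_const (A ^ 2) * fps_X + fps_const (A * B) * fps_X ^ 2"
  defines "y \<equiv> (\<lambda>m. (fps_difference g ^^ m) \<phi>)"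
  shows "(\<forall>k<1+m*d. y m $ k = 0) \<and> y m $ (1 + m * d) = A ^ (m + 2) * of_nat (odd_factorial m)
     \<and> y m $ (2 + m * d) = A ^ (m + 1) * B * of_nat (odd_factorial (Suc m))
     \<and> y m $ (3 + m * d) = A ^ m * (of_nat m * (B ^ 2 + e / 2 * A ^ 3) * of_nat (odd_factorial (Suc m))
          + (A * C - B ^ 2 - 3 / 2 * e * A ^ 3) * of_nat (odd_reciprocal_sum m))"
proof (induction m)
  case 0
  show ?case
    by (auto simp: y_def \<phi>_def odd_factorial_def fps_X_power_nth power2_eq_square)
next
  case (Suc m)
  let ?s = "1 + m * d" and ?M = "of_nat m :: 'a"
  let ?a = "of_nat (odd_factorial m) :: 'a" and ?E = "of_nat (odd_reciprocal_sum m) :: 'a"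
  have y_Suc: "y (Suc m) = fps_difference g (y m)" by (simp add: y_def)
  have low: "\<forall>k<?s. y m $ k = 0" using Suc by blast
  note diff = fps_difference_leading_coefficients[where s = ?s and \<phi> = "y m", OF tang d low, folded A_def B_def C_def y_Suc]
  have s: "of_nat ?s = 2 * ?M + 1" "of_nat (?s + 1) = 2 * ?M + 2" "of_nat (?s + 2) = 2 * ?M + 3"
    using d_char by (simp_all add: algebra_simps)
  have "2 * (?s choose 2) = ?s * (m * d)"
    by (simp add: choose_two)
  then have "2 * of_nat (?s choose 2) = (of_nat ?s * (?M * of_nat d) :: 'a)"
    by (metis of_nat_mult of_nat_numeral)
  then have "2 * of_nat (?s choose 2) = 2 * ((2 * ?M + 1) * ?M)"
    unfolding s d_char by (simp only: mult_ac)
  then have choose: "of_nat (?s choose 2) = (2 * ?M + 1) * ?M"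
    using two by (metis mult_cancel_left)
  have fac: "of_nat (odd_factorial (Suc m)) = (2 * ?M + 1) * ?a"
    "of_nat (odd_factorial (Suc (Suc m))) = (2 * ?M + 3) * ((2 * ?M + 1) * ?a)"
    by (simp_all add: odd_factorial_Suc algebra_simps)
  have conv: "of_nat (odd_reciprocal_sum (Suc m)) = (2 * ?M + 3) * ?E + (2 * ?M + 1) * ?a"
    by (simp add: odd_factorial_Suc algebra_simps)
  have y1: "y m $ ?s = A ^ (m + 2) * ?a"
    and y2: "y m $ (?s + 1) = A ^ (m + 1) * B * ((2 * ?M + 1) * ?a)"
    and y3: "y m $ (?s + 2) = A ^ m * (?M * (B ^ 2 + e / 2 * A ^ 3) * ((2 * ?M + 1) * ?a)
        + (A * C - B ^ 2 - 3 / 2 * e * A ^ 3) * ?E)"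
    using Suc unfolding fac by (simp_all add: numeral_2_eq_2 numeral_3_eq_3)
  have idx: "1 + Suc m * d = ?s + d" "2 + Suc m * d = ?s + d + 1" "3 + Suc m * d = ?s + d + 2"
    by simp_all
  have sq: "(if d = 2 then of_nat (?s choose 2) * y m $ ?s * A ^ 2 else 0)
      = e * ((2 * ?M + 1) * ?M) * (A ^ (m + 2) * ?a) * A ^ 2"
    unfolding choose y1 by (simp add: e_def)
  show ?case unfolding idx
  proof (intro conjI allI impI)
    fix k assume "k < ?s + d"
    then show "y (Suc m) $ k = 0" using diff(1) by blast
  next
    show "y (Suc m) $ (?s + d) = A ^ (Suc m + 2) * of_nat (odd_factorial (Suc m))"
      by (subst diff(2), unfold fac y1 s) (simp add: algebra_simps)
  next
    show "y (Suc m) $ (?s + d + 1) = A ^ (Suc m + 1) * B * of_nat (odd_factorial (Suc (Suc m)))"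
      by (subst diff(3), unfold fac y1 y2 s) (simp add: algebra_simps)
  next
    \<comment> \<open>Abstracting the halves leaves an identity of polynomials with integer coefficients.\<close>
    define t where "t = e / 2"
    have red: "2 * t = e" "3 / 2 * e = 3 * t" "e / 2 = t" using two by (simp_all add: t_def)
    show "y (Suc m) $ (?s + d + 2) = A ^ Suc m * (of_nat (Suc m) * (B ^ 2 + e / 2 * A ^ 3) * of_nat (odd_factorial (Suc (Suc m)))
          + (A * C - B ^ 2 - 3 / 2 * e * A ^ 3) * of_nat (odd_reciprocal_sum (Suc m)))"
      by (subst diff(4), subst sq, unfold fac conv y1 y2 y3 s red(2,3), unfold red(1)[symmetric])
        (simp add: algebra_simps power2_eq_square power3_eq_cube)
  qed
qed

lemma tangent_to_id_iterate:
  fixes g :: "'a::idom fps"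
  assumes "tangent_to_id d g" "d \<ge> 1"
  shows "tangent_to_id d (fps_iterate g n)"
proof (induction n)
  case (Suc n)
  have g0: "fps_iterate g n $ 0 = 0" using Suc by (rule tangent_to_id_nth_0)
  show ?case unfolding tangent_to_id_def
  proof (intro allI impI)
    fix k assume k: "k \<le> d"
    have "fps_difference g (fps_iterate g n) $ k = 0"
    proof (cases "k < d")
      case False
      then have "k = 0 + d" using k by simp
      then show ?thesis using fps_difference_nth(2)[OF assms, of "fps_iterate g n" 0] g0 by simp
    qed (rule fps_difference_nth(1)[OF assms])
    then show "fps_iterate g (Suc n) $ k = fps_X $ k"
      using Suc k by (simp add: fps_difference_def tangent_to_id_def)
  qed
qed (simp add: tangent_to_id_def)

text \<open>
  The lowest term of \<open>\<phi> \<circ> G - \<phi>\<close> is that of \<open>G - X\<close>, multiplied by the linear coefficient of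
  \<open>\<phi>\<close>. This transfers information about an arbitrary test series \<open>\<phi>\<close> to \<open>G\<close> itself.
\<close>

lemma tangent_to_id_from_difference:
  fixes G :: "'a::idom fps"
  assumes "tangent_to_id 1 G" "\<phi> $ 0 = 0" "\<phi> $ 1 \<noteq> 0" "N \<ge> 1"
    and low: "\<And>k. k \<le> N \<Longrightarrow> fps_difference G \<phi> $ k = 0"
  shows "tangent_to_id N G \<and> fps_difference G \<phi> $ (N + 1) = \<phi> $ 1 * G $ (N + 1)"
proof -
  have lead: "fps_difference G \<phi> $ (n + 1) = \<phi> $ 1 * G $ (n + 1)" if "tangent_to_id n G" "n \<ge> 1" for n
    using fps_difference_nth(2)[OF that, of \<phi> 1] assms(2) by (simp add: add.commute)
  have "n \<le> N \<Longrightarrow> tangent_to_id n G" if "n \<ge> 1" for n using that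
  proof (induction n rule: nat_induct_at_least)
    case (Suc n)
    have "\<phi> $ 1 * G $ (n + 1) = 0"
      using lead[of n] low[of "n + 1"] Suc by simp
    then have "G $ Suc n = 0" using assms(3) by simp
    then show ?case using Suc by (auto simp: tangent_to_id_def le_Suc_eq)
  qed (use assms(1) in simp)
  then show ?thesis using lead assms(4) by blast
qed

lemma power_eq_square_mult:
  fixes x :: "'a::monoid_mult"
  assumes "n \<ge> 2"
  shows "x ^ n = x ^ 2 * x ^ (n - 2)"
  using assms by (metis le_add_diff_inverse power_add)

text \<open>
  At \<open>m = p\<close> both odd double factorials in \<open>fps_difference_power_coefficients\<close> contain the factor
  \<open>p\<close>. So two more coefficients than expected vanish, and only the part of the third one that
  involves the reciprocal sum survives.
\<close>

lemma prime_iterate_leading_coefficient: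
  fixes g :: "'a::field fps"
  assumes "prime p" "p \<ge> 3" "CHAR('a) = p"
    and tang: "tangent_to_id d g" and d: "d \<ge> 2" and d_char: "of_nat d = (2::'a)"
  defines "A \<equiv> g $ (d + 1)" and "B \<equiv> g $ (d + 2)" and "C \<equiv> g $ (d + 3)"
  defines "e \<equiv> (if d = 2 then 1 else 0 :: 'a)"
  assumes A: "A \<noteq> 0"
  shows "tangent_to_id (p * d + 2) (fps_iterate g p)"
    and "fps_iterate g p $ (p * d + 3) = A ^ (p - 2) * (B ^ 2 - A * C + 3 / 2 * e * A ^ 3)"
proof -
  have "odd p" using assms(1,2) prime_odd_nat by auto
  then obtain h where h: "p = 2 * h + 1" by (elim oddE)
  then have h_pos: "h > 0" using assms(2) by simp
  note odd_facts = assms(1) h h_pos assms(3)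
  have two: "(2::'a) \<noteq> 0"
    using of_nat_eq_0_iff_char_dvd[of 2, where 'a = 'a] assms(2,3) by (auto dest: dvd_imp_le)
  define \<phi> where "\<phi> = fps_const (A ^ 2) * fps_X + fps_const (A * B) * fps_X ^ 2"
  have \<phi>: "\<phi> $ 0 = 0" "\<phi> $ 1 = A ^ 2" by (simp_all add: \<phi>_def fps_X_power_nth)
  define y where "y = (fps_difference g ^^ p) \<phi>"
  have y: "fps_difference (fps_iterate g p) \<phi> = y"
    unfolding y_def using fps_difference_iterate_prime[OF assms(1,3) tangent_to_id_nth_0[OF tang]] .
  note coeffs = fps_difference_power_coefficients[OF tang d d_char two, of p,
      folded A_def B_def C_def e_def, folded \<phi>_def, folded y_def]
  have fac: "of_nat (odd_factorial p) = (0::'a)" "of_nat (odd_factorial (Suc p)) = (0::'a)"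
    using of_nat_odd_factorial_eq_0[OF odd_facts] h by simp_all
  have low: "fps_difference (fps_iterate g p) \<phi> $ k = 0" if "k \<le> p * d + 2" for k
  proof -
    have "k < 1 + p * d \<or> k = 1 + p * d \<or> k = 2 + p * d" using that by linarith
    then show ?thesis using coeffs unfolding y fac by (elim disjE) simp_all
  qed
  have t1: "tangent_to_id 1 (fps_iterate g p)"
    using tangent_to_id_iterate[OF tang] d by (simp add: tangent_to_id_def)
  have concl: "tangent_to_id (p * d + 2) (fps_iterate g p) \<and>
      y $ (p * d + 2 + 1) = A ^ 2 * fps_iterate g p $ (p * d + 2 + 1)"
    using tangent_to_id_from_difference[OF t1 \<phi>(1) _ _ low] \<phi>(2) A y by simp
  then show "tangent_to_id (p * d + 2) (fps_iterate g p)" by blast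
  have "A ^ 2 * fps_iterate g p $ (p * d + 3) = y $ (3 + p * d)"
    using concl by (simp add: add.commute[of 3] numeral_3_eq_3)
  also have "\<dots> = A ^ p * ((A * C - B ^ 2 - 3 / 2 * e * A ^ 3) * (- 1))"
    using coeffs fac of_nat_odd_reciprocal_sum_prime[OF odd_facts] by simp
  also have "A ^ p = A ^ 2 * A ^ (p - 2)"
    using assms(2) by (intro power_eq_square_mult) simp
  also have "A ^ 2 * A ^ (p - 2) * ((A * C - B ^ 2 - 3 / 2 * e * A ^ 3) * (- 1))
      = A ^ 2 * (A ^ (p - 2) * (B ^ 2 - A * C + 3 / 2 * e * A ^ 3))"
    by (simp add: algebra_simps)
  finally have "A ^ 2 * fps_iterate g p $ (p * d + 3)
      = A ^ 2 * (A ^ (p - 2) * (B ^ 2 - A * C + 3 / 2 * e * A ^ 3))" .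
  then show "fps_iterate g p $ (p * d + 3) = A ^ (p - 2) * (B ^ 2 - A * C + 3 / 2 * e * A ^ 3)"
    using A by simp
qed

text \<open>
  With \<open>v = f - X\<close> and \<open>w = g - X\<close>, commutation reads \<open>v \<circ> g - v = w \<circ> f - w\<close>. To first order this
  is \<open>v' w = w' v\<close>, so that \<open>w / v\<close> has derivative zero and \<open>w\<close> is proportional to
  \<open>X\<^sup>d\<^sup>-\<^sup>2 v\<close> in the lowest terms; the correction \<open>3/2 a\<^sub>2\<^sup>2\<close> comes from the second-order
  term \<open>w'' v\<^sup>2 / 2\<close>.
\<close>

lemma commuting_series_coefficients:
  fixes f g :: "'a::field fps"
  assumes f: "tangent_to_id 2 f" and g: "tangent_to_id d g" and d: "d > 2" and d_char: "of_nat d = (2::'a)"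
    and two: "(2::'a) \<noteq> 0" and comm: "f oo g = g oo f" and a: "f $ 3 \<noteq> 0"
  shows "g $ (d + 2) = f $ 4 * g $ (d + 1) / f $ 3"
    and "g $ (d + 3) = (f $ 5 - 3 / 2 * (f $ 3) ^ 2) * g $ (d + 1) / f $ 3"
proof -
  define v w where "v = f - fps_X" and "w = g - fps_X"
  have g0: "g $ 0 = 0" and f0: "f $ 0 = 0" using f g tangent_to_id_nth_0 by blast+
  have swap: "fps_difference g v = fps_difference f w"
    using comm f0 g0 by (simp add: fps_difference_def v_def w_def fps_compose_sub_distrib)
  have v: "\<forall>k<3. v $ k = 0" "v $ 3 = f $ 3" "v $ 4 = f $ 4" "v $ 5 = f $ 5"
    using f by (auto simp: v_def tangent_to_id_def)
  have w: "\<forall>k<d + 1. w $ k = 0" "w $ (d + 1) = g $ (d + 1)" "w $ (d + 2) = g $ (d + 2)" "w $ (d + 3) = g $ (d + 3)"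
    using g d by (auto simp: w_def tangent_to_id_def)
  have n: "of_nat (d + 1) = (3::'a)" "of_nat (d + 2) = (4::'a)" "of_nat (d + 3) = (5::'a)"
    using d_char by simp_all
  have "2 * (d + 1 choose 2) = (d + 1) * d" by (simp add: choose_two)
  then have "2 * of_nat (d + 1 choose 2) = (of_nat (d + 1) * of_nat d :: 'a)"
    by (metis of_nat_mult of_nat_numeral)
  then have "2 * of_nat (d + 1 choose 2) = 2 * (3::'a)" unfolding n d_char by simp
  then have choose: "of_nat (d + 1 choose 2) = (3::'a)" using two by (metis mult_cancel_left)
  have d2: "d \<ge> 2" using d by simp
  note G = fps_difference_leading_coefficients[where s = 3 and \<phi> = v, OF g d2 v(1)]
  note F = fps_difference_leading_coefficients[where s = "d + 1" and \<phi> = w, OF f order_refl w(1)]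
  have idx: "d + 1 + 2 + 1 = 3 + d + 1" "d + 1 + 2 + 2 = 3 + d + 2" "3 + 1 = (4::nat)" "3 + 2 = (5::nat)"
    "d + 3 + 1 = 3 + d + 1" "d + 3 + 2 = 3 + d + 2"
    "d + 1 + 1 = d + 2" "d + 1 + 2 = d + 3" "2 + 1 = (3::nat)" "2 + 2 = (4::nat)" "2 + 3 = (5::nat)" by simp_all
  note G' = G(3,4)[unfolded idx v(2-4) n of_nat_numeral] and F' = F(3,4)[unfolded idx w(2-4) n of_nat_numeral, folded swap]
  have "4 * (f $ 4 * g $ (d + 1)) + 3 * (f $ 3 * g $ (d + 2)) = 4 * (g $ (d + 2) * f $ 3) + 3 * (g $ (d + 1) * f $ 4)"
    using trans[OF G'(1)[symmetric] F'(1)] by (simp add: mult_ac)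
  then have 1: "f $ 3 * g $ (d + 2) = f $ 4 * g $ (d + 1)" by (simp add: algebra_simps)
  show "g $ (d + 2) = f $ 4 * g $ (d + 1) / f $ 3"
    using 1 a by (simp add: eq_divide_eq mult.commute)
  have "5 * (f $ 5 * g $ (d + 1)) + 4 * (f $ 4 * g $ (d + 2)) + 3 * (f $ 3 * g $ (d + 3)) =
      5 * (g $ (d + 3) * f $ 3) + 4 * (g $ (d + 2) * f $ 4) + 3 * (g $ (d + 1) * f $ 5) + 3 * g $ (d + 1) * (f $ 3) ^ 2"
    using trans[OF G'(2)[symmetric] F'(2)] d choose by (simp add: mult_ac)
  then have "2 * (f $ 3 * g $ (d + 3)) = 2 * (f $ 5 * g $ (d + 1)) - 3 * (f $ 3) ^ 2 * g $ (d + 1)"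
    unfolding 1 by (simp add: algebra_simps)
  also have "3 * (f $ 3) ^ 2 = 2 * (3 / 2 * (f $ 3) ^ 2)" using two by simp
  finally have "2 * (f $ 3 * g $ (d + 3)) = 2 * ((f $ 5 - 3 / 2 * (f $ 3) ^ 2) * g $ (d + 1))"
    by (simp only: left_diff_distrib right_diff_distrib mult.assoc)
  then have "f $ 3 * g $ (d + 3) = (f $ 5 - 3 / 2 * (f $ 3) ^ 2) * g $ (d + 1)"
    using two by (metis mult_cancel_left)
  then show "g $ (d + 3) = (f $ 5 - 3 / 2 * (f $ 3) ^ 2) * g $ (d + 1) / f $ 3"
    using a by (simp add: eq_divide_eq mult.commute)
qed

text \<open>
  Writing \<open>a L\<close> for the leading coefficient at stage \<open>n\<close>, commutation gives \<open>b L\<close> and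
  \<open>(c - 3/2 a\<^sup>2) L\<close> for the next two (for \<open>n = 0\<close>, where \<open>L = 1\<close>, they are \<open>b\<close> and \<open>c\<close>, and the missing
  correction is supplied by the extra term of the case \<open>d = 2\<close>). Hence the leading coefficient at stage
  \<open>n + 1\<close> is \<open>a L\<^sup>p \<lambda>\<close>, so \<open>L\<close> is replaced by \<open>L\<^sup>p \<lambda>\<close>.
\<close>

lemma prime_power_iterate_leading_coefficient:
  fixes f :: "'a::field fps"
  assumes p: "prime p" "p \<ge> 3" "CHAR('a) = p" and f: "tangent_to_id 2 f"
  defines "a \<equiv> f $ 3" and "b \<equiv> f $ 4" and "c \<equiv> f $ 5"
  defines "lam \<equiv> a ^ (p - 3) * (3 / 2 * a ^ 3 + b ^ 2 - a * c)"
  defines "d \<equiv> (\<lambda>n. 2 * (\<Sum>i\<le>n. p ^ i))"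
  assumes a: "a \<noteq> 0" and lam: "lam \<noteq> 0"
  shows "tangent_to_id (d n) (fps_iterate f (p ^ n)) \<and>
    fps_iterate f (p ^ n) $ (d n + 1) = a * lam ^ (\<Sum>i<n. p ^ i)"
proof (induction n)
  case 0
  have "fps_iterate f (p ^ 0) = f" using tangent_to_id_nth_0[OF f] by simp
  then show ?case using f by (simp add: d_def a_def numeral_3_eq_3)
next
  case (Suc n)
  let ?g = "fps_iterate f (p ^ n)" and ?M = "lam ^ (\<Sum>i<n. p ^ i)"
  have f0: "f $ 0 = 0" using f by (rule tangent_to_id_nth_0)
  have two: "(2::'a) \<noteq> 0"
    using of_nat_eq_0_iff_char_dvd[of 2, where 'a = 'a] p by (auto dest: dvd_imp_le)
  have d_Suc: "d (Suc n) = p * d n + 2"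
    unfolding d_def sum.atMost_Suc_shift by (simp add: sum_distrib_left mult_ac)
  have exp_Suc: "(\<Sum>i<Suc n. p ^ i) = 1 + p * (\<Sum>i<n. p ^ i)"
    unfolding sum.lessThan_Suc_shift by (simp add: sum_distrib_left)
  have "d n = 2 + (\<Sum>i<n. 2 * p ^ Suc i)"
    unfolding d_def by (simp add: sum.atMost_shift sum_distrib_left)
  then have "d n = 2 + p * (2 * (\<Sum>i<n. p ^ i))" by (simp add: sum_distrib_left mult_ac)
  then have d_char: "of_nat (d n) = (2::'a)" and d2: "d n \<ge> 2"
    using p(3) of_nat_CHAR[where 'a = 'a] by (simp_all)
  have iter: "fps_iterate f (p ^ Suc n) = fps_iterate ?g p"
    using fps_iterate_mult[OF f0, of "p ^ n" p] by (simp add: mult.commute)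
  have A: "?g $ (d n + 1) = a * ?M" "?g $ (d n + 1) \<noteq> 0" using Suc a lam by simp_all
  have tang: "tangent_to_id (d n) ?g" using Suc by blast
  note main = prime_iterate_leading_coefficient[OF p tang d2 d_char A(2)]
  have regroup: "(a * M) ^ (p - 2) * (M ^ 2 * E) = a * (M ^ p * (a ^ (p - 3) * E))" for M E :: 'a
  proof -
    have "M ^ p = M ^ 2 * M ^ (p - 2)" using p(2) by (intro power_eq_square_mult) simp
    moreover have "p - 2 = Suc (p - 3)" using p(2) by simp
    then have "a ^ (p - 2) = a * a ^ (p - 3)" by simp
    ultimately show ?thesis by (simp only: power_mult_distrib mult_ac)
  qed
  have "(?g $ (d n + 2)) ^ 2 - ?g $ (d n + 1) * ?g $ (d n + 3) + 3 / 2 * (if d n = 2 then 1 else 0) * (?g $ (d n + 1)) ^ 3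
      = ?M ^ 2 * (3 / 2 * a ^ 3 + b ^ 2 - a * c)"
  proof (cases n)
    case 0
    then have "d n + 1 = 3" "d n + 2 = 4" "d n + 3 = 5" "d n = 2" by (simp_all add: d_def)
    then show ?thesis using 0 f0 by (simp add: a_def b_def c_def)
  next
    case (Suc j)
    have "p ^ n > 0" using p by simp
    then have "d n > 2" using Suc unfolding \<open>d n = 2 + p * _\<close> using p(2)
      by (simp add: sum.lessThan_Suc_shift)
    moreover have "f oo ?g = ?g oo f"
      using fps_iterate_add[OF f0, of 1 "p ^ n"] fps_iterate_add[OF f0, of "p ^ n" 1] f0 by simp
    ultimately have BC: "?g $ (d n + 2) = b * ?M" "?g $ (d n + 3) = (c - 3 / 2 * a ^ 2) * ?M" "d n \<noteq> 2"
      using commuting_series_coefficients[OF f tang _ d_char two] a A(1)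
      by (simp_all add: a_def b_def c_def)
    define t where "t = (3 / 2 :: 'a)"
    show ?thesis unfolding A(1) BC(1,2) t_def[symmetric] using BC(3)
      by (simp add: algebra_simps power2_eq_square power3_eq_cube)
  qed
  then have "fps_iterate ?g p $ (p * d n + 3) = (a * ?M) ^ (p - 2) * (?M ^ 2 * (3 / 2 * a ^ 3 + b ^ 2 - a * c))"
    using main(2) A(1) by simp
  also have "\<dots> = a * (?M ^ p * lam)"
    unfolding regroup lam_def ..
  also have "?M ^ p * lam = lam ^ (\<Sum>i<Suc n. p ^ i)"
    unfolding exp_Suc by (simp add: power_add mult.commute flip: power_mult)
  finally show ?case using main(1) unfolding iter d_Suc by (simp add: numeral_3_eq_3)
qed

section \<open>Integral series and their zeros over an ultrametric field\<close>

text \<open>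
  The series \<open>\<Sum> R\<^sub>n (G\<^sup>n - X\<^sup>n) / (G - X)\<close>. Since \<open>(G\<^sup>n - X\<^sup>n) / (G - X)\<close> has no terms below \<open>X\<^sup>n\<^sup>-\<^sup>1\<close> when
  \<open>G\<close> has no constant term, each coefficient is a finite sum. An explicit formula is needed,
  since division of series would not show that the coefficients stay in the closed unit disk when
  the leading coefficient of \<open>G - X\<close> is small.
\<close>

definition fps_difference_quotient :: "'a::comm_ring_1 fps \<Rightarrow> 'a fps \<Rightarrow> 'a fps" where
  "fps_difference_quotient G R =
     Abs_fps (\<lambda>m. \<Sum>n\<le>Suc m. R $ n * (\<Sum>i<n. fps_X ^ (n - Suc i) * G ^ i) $ m)"

lemma fps_difference_quotient_nth_0:
  "fps_difference_quotient G R $ 0 = R $ 1"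
  by (simp add: fps_difference_quotient_def)

lemma fps_difference_eq_mult_quotient:
  fixes G :: "'a::idom fps"
  assumes G: "G $ 0 = 0"
  shows "fps_difference G R = (G - fps_X) * fps_difference_quotient G R"
proof (rule fps_ext)
  fix M
  define S where "S n = (\<Sum>i<n. fps_X ^ (n - Suc i) * G ^ i)" for n
  have S_low: "S n $ m = 0" if "Suc m < n" for n m
  proof -
    have "(fps_X ^ (n - Suc i) * G ^ i) $ m = 0" if "i < n" for i
    proof (cases "m < n - Suc i")
      case False
      then have "m - (n - Suc i) < i" using \<open>Suc m < n\<close> that by auto
      then show ?thesis using False startsby_zero_power_prefix[OF G] by (simp add: fps_X_power_mult_nth)
    qed (simp add: fps_X_power_mult_nth)
    then show ?thesis by (simp add: S_def fps_sum_nth)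
  qed
  define T where "T = (\<Sum>n\<le>Suc M. fps_const (R $ n) * S n)"
  have T: "fps_difference_quotient G R $ m = T $ m" if "m \<le> M" for m
  proof -
    have "fps_difference_quotient G R $ m = (\<Sum>n\<le>Suc m. R $ n * S n $ m)"
      by (simp add: fps_difference_quotient_def S_def)
    also have "\<dots> = (\<Sum>n\<le>Suc M. R $ n * S n $ m)"
      by (rule sum.mono_neutral_left) (use that in \<open>auto simp: S_low\<close>)
    finally show ?thesis by (simp add: T_def fps_sum_nth)
  qed
  have geo: "(G - fps_X) * S n = G ^ n - fps_X ^ n" for n
    unfolding S_def by (rule power_diff_sumr2[symmetric])
  have "(G - fps_X) * T = (\<Sum>n\<le>Suc M. fps_const (R $ n) * (G ^ n - fps_X ^ n))"
    unfolding T_def sum_distrib_left geo[symmetric] by (simp only: mult_ac)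
  then have "((G - fps_X) * T) $ M = (\<Sum>n\<le>Suc M. R $ n * (G ^ n) $ M) - (\<Sum>n\<le>Suc M. R $ n * (fps_X ^ n) $ M)"
    by (simp add: fps_sum_nth right_diff_distrib sum_subtractf del: sum.atMost_Suc)
  also have "(\<Sum>n\<le>Suc M. R $ n * (G ^ n) $ M) = (R oo G) $ M"
    using startsby_zero_power_prefix[OF G, of "Suc M"] by (simp add: fps_compose_nth atMost_atLeast0)
  also have "(\<Sum>n\<le>Suc M. R $ n * (fps_X ^ n) $ M) = R $ M"
    by (simp add: fps_X_power_nth if_distrib sum.delta cong: if_cong)
  finally have "((G - fps_X) * T) $ M = fps_difference G R $ M" by (simp add: fps_difference_def)
  moreover have "((G - fps_X) * fps_difference_quotient G R) $ M = ((G - fps_X) * T) $ M"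
    unfolding fps_mult_nth by (rule sum.cong) (auto simp: T)
  ultimately show "fps_difference G R $ M = ((G - fps_X) * fps_difference_quotient G R) $ M" by simp
qed

context ultrametric_field
begin

lemma absv_0 [simp]: "absv 0 = 0"
  by (simp add: absv_eq_0_iff)

lemma absv_1 [simp]: "absv 1 = 1"
  using absv_mult[of 1 1] absv_eq_0_iff[of 1] by simp

lemma absv_power: "absv (x ^ n) = absv x ^ n"
  by (induction n) (simp_all add: absv_mult)

lemma absv_diff_le_max: "absv (x - y) \<le> max (absv x) (absv y)"
  using absv_add_le_max[of x "- y"] by (simp add: absv_uminus)

lemma absv_prod: "absv (\<Prod>i\<in>A. f i) = (\<Prod>i\<in>A. absv (f i))"
  by (induction A rule: infinite_finite_induct) (simp_all add: absv_mult)

lemma absv_add_le: "absv x \<le> c \<Longrightarrow> absv y \<le> c \<Longrightarrow> absv (x + y) \<le> c"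
  using absv_add_le_max[of x y] by linarith

lemma absv_diff_le: "absv x \<le> c \<Longrightarrow> absv y \<le> c \<Longrightarrow> absv (x - y) \<le> c"
  using absv_diff_le_max[of x y] by linarith

lemma absv_diff_commute: "absv (x - y) = absv (y - x)"
  using absv_uminus[of "x - y"] by simp

lemma absv_sum_le:
  assumes "\<And>i. i \<in> A \<Longrightarrow> absv (f i) \<le> c" "0 \<le> c"
  shows "absv (sum f A) \<le> c"
  using assms
proof (induction A rule: infinite_finite_induct)
  case (insert i A)
  then show ?case by (simp add: absv_add_le)
qed (simp_all)

lemma absv_of_nat_le_1: "absv (of_nat n) \<le> 1"
proof (induction n)
  case (Suc n)
  then show ?case using absv_add_le_max[of 1 "of_nat n"] by simp
qed simp

text \<open>
  An integer prime to the characteristic has an integer inverse in the field, and no integer has absolute value above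
  \<open>1\<close>.
\<close>

lemma absv_of_nat_coprime_char:
  assumes "prime p" "CHAR('a) = p" "\<not> p dvd t"
  shows "absv (of_nat t) = 1"
proof -
  have "coprime t p" using assms by (simp add: prime_imp_coprime coprime_commute)
  then obtain u where "[t * u = 1] (mod p)" using cong_solve_coprime_nat by (metis One_nat_def)
  then have "(of_nat (t * u) :: 'a) = of_nat 1" using of_nat_eq_iff_cong_CHAR assms(2) by blast
  then have "absv (of_nat t) * absv (of_nat u) = 1" by (metis absv_1 absv_mult of_nat_1 of_nat_mult)
  moreover have "absv (of_nat t) * absv (of_nat u) \<le> absv (of_nat t) * 1"
    using absv_nonneg absv_of_nat_le_1 by (intro mult_left_mono)
  ultimately show ?thesis using absv_of_nat_le_1[of t] by simp
qed

definition integral_fps :: "'a fps \<Rightarrow> bool" where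
  "integral_fps F \<longleftrightarrow> (\<forall>n. absv (F $ n) \<le> 1)"

lemma integral_fps_const: "absv c \<le> 1 \<Longrightarrow> integral_fps (fps_const c)"
  by (simp add: integral_fps_def)

lemma integral_fps_1: "integral_fps 1"
  by (simp add: integral_fps_def)

lemma integral_fps_X: "integral_fps fps_X"
  by (simp add: integral_fps_def fps_X_def)

lemma integral_fps_add: "integral_fps F \<Longrightarrow> integral_fps G \<Longrightarrow> integral_fps (F + G)"
  unfolding integral_fps_def by (simp add: absv_add_le)

lemma integral_fps_diff: "integral_fps F \<Longrightarrow> integral_fps G \<Longrightarrow> integral_fps (F - G)"
  unfolding integral_fps_def by (simp add: absv_diff_le)

lemma integral_fps_sum: "(\<And>i. i \<in> I \<Longrightarrow> integral_fps (F i)) \<Longrightarrow> integral_fps (sum F I)"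
  unfolding integral_fps_def fps_sum_nth by (intro allI absv_sum_le) auto

lemma absv_mult_le_1: "absv x \<le> 1 \<Longrightarrow> absv y \<le> 1 \<Longrightarrow> absv (x * y) \<le> 1"
  by (simp add: absv_mult absv_nonneg mult_le_one)

lemma integral_fps_mult: "integral_fps F \<Longrightarrow> integral_fps G \<Longrightarrow> integral_fps (F * G)"
  unfolding integral_fps_def fps_mult_nth by (intro allI absv_sum_le absv_mult_le_1) auto

lemma integral_fps_power: "integral_fps F \<Longrightarrow> integral_fps (F ^ n)"
  by (induction n) (simp_all add: integral_fps_1 integral_fps_mult)

lemma integral_fps_compose: "integral_fps F \<Longrightarrow> integral_fps G \<Longrightarrow> integral_fps (F oo G)"
  using integral_fps_power[of G] unfolding integral_fps_def fps_compose_nth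
  by (intro allI absv_sum_le absv_mult_le_1) auto

lemma integral_fps_iterate: "integral_fps F \<Longrightarrow> integral_fps (fps_iterate F n)"
  by (induction n) (simp_all add: integral_fps_X integral_fps_compose)

lemma integral_fps_difference_quotient:
  assumes "integral_fps G" "integral_fps R"
  shows "integral_fps (fps_difference_quotient G R)"
proof -
  have "integral_fps (\<Sum>i<n. fps_X ^ (n - Suc i) * G ^ i)" for n
    using assms by (intro integral_fps_sum integral_fps_mult integral_fps_power integral_fps_X)
  then show ?thesis using assms(2)
    unfolding integral_fps_def fps_difference_quotient_def fps_nth_Abs_fps
    by (intro allI absv_sum_le absv_mult_le_1) auto
qed

text \<open>
  Telescoping \<open>G\<^sup>t - X\<close> into the differences \<open>G\<^sup>j \<circ> G - G\<^sup>j\<close>, each of which is \<open>G - X\<close> times a series with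
  constant term \<open>1\<close>. The constant term \<open>t\<close> excludes period factors prime to the
  characteristic.
\<close>

lemma iterate_minus_id_factor:
  assumes "integral_fps G" "tangent_to_id 1 G"
  shows "\<exists>Q. integral_fps Q \<and> fps_iterate G t - fps_X = (G - fps_X) * Q \<and> Q $ 0 = of_nat t"
proof (induction t)
  case 0
  then show ?case by (intro exI[of _ 0]) (simp add: integral_fps_def)
next
  case (Suc t)
  then obtain Q where Q: "integral_fps Q" "fps_iterate G t - fps_X = (G - fps_X) * Q" "Q $ 0 = of_nat t"
    by blast
  let ?R = "fps_difference_quotient G (fps_iterate G t)"
  have "fps_iterate G t $ 1 = 1"
    using tangent_to_id_iterate[OF assms(2)] by (simp add: tangent_to_id_def)
  moreover have "fps_iterate G (Suc t) - fps_X = fps_difference G (fps_iterate G t) + (fps_iterate G t - fps_X)"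
    by (simp add: fps_difference_def)
  moreover have "fps_difference G (fps_iterate G t) = (G - fps_X) * ?R"
    using fps_difference_eq_mult_quotient tangent_to_id_nth_0[OF assms(2)] by blast
  ultimately show ?case
    using Q assms(1)
    by (intro exI[of _ "?R + Q"])
      (simp add: fps_difference_quotient_nth_0 distrib_left integral_fps_add
        integral_fps_difference_quotient integral_fps_iterate)
qed

definition partial_value :: "'a fps \<Rightarrow> 'a \<Rightarrow> nat \<Rightarrow> 'a" where
  "partial_value F z N = (\<Sum>i<N. F $ i * z ^ i)"

lemma absv_term_le:
  assumes "integral_fps F" "absv z \<le> 1" "N \<le> i"
  shows "absv (F $ i * z ^ i) \<le> absv z ^ N"
proof -
  have "absv (F $ i * z ^ i) \<le> 1 * absv z ^ i"
    unfolding absv_mult absv_power using assms(1) absv_nonneg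
    by (intro mult_right_mono) (auto simp: integral_fps_def)
  also have "1 * absv z ^ i \<le> absv z ^ N" using assms absv_nonneg by (simp add: power_decreasing)
  finally show ?thesis .
qed

text \<open>
  For an ultrametric absolute value the tail after \<open>N\<close> terms is as small as its largest term. This turns
  convergence into a uniform bound, which is easy to carry through algebraic operations.
\<close>

lemma fps_has_value_iff_partial_value_bound:
  assumes F: "integral_fps F" and z: "absv z < 1"
  shows "fps_has_value absv F z s \<longleftrightarrow> (\<forall>N. absv (partial_value F z N - s) \<le> absv z ^ N)"
proof
  assume "fps_has_value absv F z s"
  then have lim: "(\<lambda>M. absv (partial_value F z M - s)) \<longlonglongrightarrow> 0"
    by (simp add: fps_has_value_def partial_value_def)
  show "\<forall>N. absv (partial_value F z N - s) \<le> absv z ^ N"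
  proof
    fix N
    have bound: "absv (partial_value F z N - s) \<le> max (absv (partial_value F z M - s)) (absv z ^ N)"
      if "M \<ge> N" for M
    proof -
      have "partial_value F z M - partial_value F z N = (\<Sum>i=N..<M. F $ i * z ^ i)"
        unfolding partial_value_def using that by (simp add: sum_diff_nat_ivl lessThan_atLeast0)
      then have tail: "absv (partial_value F z M - partial_value F z N) \<le> absv z ^ N"
        using F z absv_nonneg by (auto intro!: absv_sum_le absv_term_le)
      have "absv (partial_value F z N - s) \<le>
          max (absv (partial_value F z M - s)) (absv (partial_value F z M - partial_value F z N))"
        using absv_diff_le_max[of "partial_value F z M - s" "partial_value F z M - partial_value F z N"] by simp
      then show ?thesis using tail by linarith
    qed
    have "(\<lambda>M. max (absv (partial_value F z M - s)) (absv z ^ N)) \<longlonglongrightarrow> max 0 (absv z ^ N)"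
      using lim by (intro tendsto_max tendsto_const)
    then have "absv (partial_value F z N - s) \<le> max 0 (absv z ^ N)"
      by (rule LIMSEQ_le_const) (use bound in blast)
    then show "absv (partial_value F z N - s) \<le> absv z ^ N" using absv_nonneg[of z] by simp
  qed
next
  assume bound: "\<forall>N. absv (partial_value F z N - s) \<le> absv z ^ N"
  have lim: "(\<lambda>N. absv z ^ N) \<longlonglongrightarrow> 0" using absv_nonneg[of z] z by (intro LIMSEQ_realpow_zero)
  have "(\<lambda>N. absv (partial_value F z N - s)) \<longlonglongrightarrow> 0"
    by (rule tendsto_sandwich[OF _ _ tendsto_const lim]) (use bound absv_nonneg in auto)
  then show "fps_has_value absv F z s" by (simp add: fps_has_value_def partial_value_def)
qed

lemma partial_value_mult:
  assumes "integral_fps F" "integral_fps G" "absv z \<le> 1"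
  shows "absv (partial_value F z N * partial_value G z N - partial_value (F * G) z N) \<le> absv z ^ N"
proof -
  let ?h = "\<lambda>i j. F $ i * G $ j * z ^ (i + j)"
  have sub: "{(i, j). i + j < N} \<subseteq> {..<N} \<times> {..<N}" by auto
  have "partial_value (F * G) z N = (\<Sum>k<N. \<Sum>i\<le>k. ?h i (k - i))"
    unfolding partial_value_def fps_mult_nth sum_distrib_right atMost_atLeast0 by (intro sum.cong) auto
  also have "\<dots> = (\<Sum>(i, j)\<in>{(i, j). i + j < N}. ?h i j)" by (rule sum.triangle_reindex[symmetric])
  finally have 1: "partial_value (F * G) z N = (\<Sum>(i, j)\<in>{(i, j). i + j < N}. ?h i j)" .
  have "partial_value F z N * partial_value G z N = (\<Sum>(i, j)\<in>{..<N} \<times> {..<N}. ?h i j)"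
    unfolding partial_value_def sum_product sum.cartesian_product by (intro sum.cong) (auto simp: power_add)
  then have eq: "partial_value F z N * partial_value G z N - partial_value (F * G) z N
      = (\<Sum>(i, j)\<in>{..<N} \<times> {..<N} - {(i, j). i + j < N}. ?h i j)"
    using sub unfolding 1 by (simp add: sum_diff)
  have term_le: "absv (?h i j) \<le> absv z ^ N" if "N \<le> i + j" for i j
  proof -
    have "absv (?h i j) \<le> 1 * absv z ^ (i + j)"
      unfolding absv_mult[of _ "z ^ _"] absv_power using assms absv_nonneg
      by (intro mult_right_mono absv_mult_le_1) (auto simp: integral_fps_def)
    also have "\<dots> \<le> absv z ^ N" using assms that absv_nonneg by (simp add: power_decreasing)
    finally show ?thesis .
  qed
  show ?thesis unfolding eq using absv_nonneg[of z] term_le by (intro absv_sum_le) (auto simp: not_less)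
qed

lemma absv_partial_value_le_1:
  assumes "integral_fps F" "absv z \<le> 1"
  shows "absv (partial_value F z N) \<le> 1"
  unfolding partial_value_def using absv_term_le[OF assms, of 0] by (intro absv_sum_le) auto

lemma absv_fps_value_le_1:
  assumes "integral_fps F" "absv z < 1" "fps_has_value absv F z s"
  shows "absv s \<le> 1"
  using fps_has_value_iff_partial_value_bound[OF assms(1,2), of s] assms(3)
  by (metis absv_0 absv_diff_commute diff_zero lessThan_0 partial_value_def power_0 sum.empty)

lemma fps_has_value_diff:
  assumes "integral_fps F" "integral_fps G" "absv z < 1"
    and "fps_has_value absv F z s" "fps_has_value absv G z t"
  shows "fps_has_value absv (F - G) z (s - t)"
proof -
  have "absv (partial_value (F - G) z N - (s - t)) \<le> absv z ^ N" for N
  proof -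
    have "partial_value (F - G) z N - (s - t) = (partial_value F z N - s) - (partial_value G z N - t)"
      by (simp add: partial_value_def left_diff_distrib sum_subtractf)
    then show ?thesis
      using absv_diff_le_max[of "partial_value F z N - s" "partial_value G z N - t"] assms
        fps_has_value_iff_partial_value_bound[of F z s] fps_has_value_iff_partial_value_bound[of G z t]
      by (smt (verit))
  qed
  then show ?thesis using fps_has_value_iff_partial_value_bound integral_fps_diff assms(1-3) by blast
qed

lemma fps_has_value_mult:
  assumes "integral_fps F" "integral_fps G" "absv z < 1"
    and "fps_has_value absv F z s" "fps_has_value absv G z t"
  shows "fps_has_value absv (F * G) z (s * t)"
proof -
  have "absv (partial_value (F * G) z N - s * t) \<le> absv z ^ N" for N
  proof -
    let ?F = "partial_value F z N" and ?G = "partial_value G z N"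
    have "absv (?F - s) \<le> absv z ^ N" "absv (?G - t) \<le> absv z ^ N"
      using assms fps_has_value_iff_partial_value_bound by blast+
    moreover have "absv ?F \<le> 1" "absv t \<le> 1"
      using assms absv_partial_value_le_1 absv_fps_value_le_1 by (auto intro: less_imp_le)
    ultimately have "absv (?F * (?G - t)) \<le> absv z ^ N" "absv ((?F - s) * t) \<le> absv z ^ N"
      unfolding absv_mult using absv_nonneg by (meson mult_left_le_one_le mult_right_le_one_le order_trans)+
    then have 1: "absv (?F * (?G - t) + (?F - s) * t) \<le> absv z ^ N"
      using absv_add_le_max[of "?F * (?G - t)" "(?F - s) * t"] by linarith
    have 2: "absv (?F * ?G - partial_value (F * G) z N) \<le> absv z ^ N"
      using assms by (intro partial_value_mult) auto
    have eq: "partial_value (F * G) z N - s * t =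
        (?F * (?G - t) + (?F - s) * t) - (?F * ?G - partial_value (F * G) z N)"
      by (simp add: algebra_simps)
    show ?thesis unfolding eq using 1 2 by (rule absv_diff_le)
  qed
  then show ?thesis using fps_has_value_iff_partial_value_bound integral_fps_mult assms(1-3) by blast
qed

lemma fps_has_value_sum:
  fixes F :: "nat \<Rightarrow> 'a fps"
  assumes "\<And>i. i < n \<Longrightarrow> fps_has_value absv (F i) z (s i)" "\<And>i. i < n \<Longrightarrow> integral_fps (F i)" "absv z < 1"
  shows "fps_has_value absv (\<Sum>i<n. F i) z (\<Sum>i<n. s i)"
proof -
  have int: "integral_fps (\<Sum>i<n. F i)" using assms(2) by (intro integral_fps_sum) auto
  have "partial_value (\<Sum>i<n. F i) z N = (\<Sum>i<n. partial_value (F i) z N)" for N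
    unfolding partial_value_def fps_sum_nth sum_distrib_right by (rule sum.swap)
  then have eq: "partial_value (\<Sum>i<n. F i) z N - (\<Sum>i<n. s i) = (\<Sum>i<n. partial_value (F i) z N - s i)" for N
    by (simp add: sum_subtractf)
  have "absv (partial_value (\<Sum>i<n. F i) z N - (\<Sum>i<n. s i)) \<le> absv z ^ N" for N
    unfolding eq using assms fps_has_value_iff_partial_value_bound absv_nonneg
    by (intro absv_sum_le) auto
  then show ?thesis using fps_has_value_iff_partial_value_bound[OF int assms(3)] by blast
qed

lemma fps_has_value_eventually_const:
  assumes "\<And>N. N \<ge> M \<Longrightarrow> partial_value F z N = s"
  shows "fps_has_value absv F z s"
  unfolding fps_has_value_def partial_value_def[symmetric]
  by (rule tendsto_eventually, unfold eventually_sequentially) (use assms in \<open>auto intro!: exI[of _ M]\<close>)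

lemma fps_has_value_const: "fps_has_value absv (fps_const c) z c"
proof (rule fps_has_value_eventually_const[of 1])
  fix N :: nat assume "N \<ge> 1"
  have "partial_value (fps_const c) z N = (\<Sum>i<N. if i = 0 then c else 0)"
    unfolding partial_value_def by (rule sum.cong) auto
  then show "partial_value (fps_const c) z N = c" using \<open>N \<ge> 1\<close> by simp
qed

lemma fps_has_value_X: "fps_has_value absv fps_X z z"
proof (rule fps_has_value_eventually_const[of 2])
  fix N :: nat assume "N \<ge> 2"
  have "partial_value fps_X z N = (\<Sum>i<N. if i = 1 then z else 0)"
    unfolding partial_value_def by (rule sum.cong) auto
  then show "partial_value fps_X z N = z" using \<open>N \<ge> 2\<close> by simp
qed

lemma fps_has_value_power:
  assumes "integral_fps F" "absv z < 1" "fps_has_value absv F z s"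
  shows "fps_has_value absv (F ^ n) z (s ^ n)"
proof (induction n)
  case 0
  then show ?case using fps_has_value_const[of 1 z] by simp
qed (simp add: fps_has_value_mult assms integral_fps_power)

lemma absv_fps_value_le:
  assumes "integral_fps F" "absv z < 1" "F $ 0 = 0" "fps_has_value absv F z s"
  shows "absv s \<le> absv z"
proof -
  have "absv (partial_value F z 1 - s) \<le> absv z ^ 1"
    using assms fps_has_value_iff_partial_value_bound by blast
  then show ?thesis using assms(3) absv_uminus[of s] by (simp add: partial_value_def)
qed

lemma fps_has_value_compose:
  assumes F: "integral_fps F" and G: "integral_fps G" "G $ 0 = 0" and z: "absv z < 1"
    and w: "fps_has_value absv G z w" and u: "fps_has_value absv F w u"
  shows "fps_has_value absv (F oo G) z u"
proof -
  have wz: "absv w \<le> absv z" using absv_fps_value_le G z w by blast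
  have "absv (partial_value (F oo G) z N - u) \<le> absv z ^ N" for N
  proof -
    define T where "T = (\<Sum>i<N. fps_const (F $ i) * G ^ i)"
    have int: "integral_fps (fps_const (F $ i) * G ^ i)" for i
      using F G by (intro integral_fps_mult integral_fps_power integral_fps_const) (auto simp: integral_fps_def)
    have "fps_has_value absv T z (partial_value F w N)"
      unfolding T_def partial_value_def using F G z w int
      by (intro fps_has_value_sum fps_has_value_mult fps_has_value_const fps_has_value_power
          integral_fps_power integral_fps_const) (auto simp: integral_fps_def)
    moreover have "integral_fps T" unfolding T_def using int by (intro integral_fps_sum)
    ultimately have 1: "absv (partial_value T z N - partial_value F w N) \<le> absv z ^ N"
      using z fps_has_value_iff_partial_value_bound by blast
    have "(F oo G) $ m = T $ m" if "m < N" for m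
    proof -
      have "(\<Sum>i\<in>{0..m}. F $ i * (G ^ i) $ m) = (\<Sum>i<N. F $ i * (G ^ i) $ m)"
        using startsby_zero_power_prefix[OF G(2)] that by (intro sum.mono_neutral_left) auto
      then show ?thesis by (simp add: T_def fps_sum_nth fps_compose_nth)
    qed
    then have "partial_value (F oo G) z N = partial_value T z N" by (simp add: partial_value_def)
    moreover have "absv (partial_value F w N - u) \<le> absv w ^ N"
      using F u wz z fps_has_value_iff_partial_value_bound by force
    moreover have "absv w ^ N \<le> absv z ^ N" using wz absv_nonneg by (intro power_mono)
    ultimately show ?thesis
      using 1 absv_add_le_max[of "partial_value T z N - partial_value F w N" "partial_value F w N - u"]
      by simp
  qed
  then show ?thesis using fps_has_value_iff_partial_value_bound integral_fps_compose F G(1) z by blast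
qed

text \<open>
  Convergence of the cofactor \<open>V\<close> is part of the conclusion. In a field
  that is not complete it has to be proved: it holds because the partial values of \<open>V\<close>, multiplied by a nonzero limit,
  tend to zero.
\<close>

lemma fps_has_value_0_cancel_factor:
  assumes "integral_fps U" "integral_fps V" "absv z < 1"
    and u: "fps_has_value absv U z u" "u \<noteq> 0" and "fps_has_value absv (U * V) z 0"
  shows "fps_has_value absv V z 0"
proof -
  have z_lim: "(\<lambda>N. absv z ^ N) \<longlonglongrightarrow> 0" using absv_nonneg[of z] assms(3) by (intro LIMSEQ_realpow_zero)
  have u_pos: "absv u > 0" using u(2) absv_nonneg[of u] absv_eq_0_iff[of u] by linarith
  have bound: "absv (partial_value V z N) \<le> absv z ^ N / absv u" for N
  proof -
    let ?U = "partial_value U z N" and ?V = "partial_value V z N"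
    have V1: "absv ?V \<le> 1" using assms by (intro absv_partial_value_le_1) auto
    have "absv (?U - u) \<le> absv z ^ N" using assms fps_has_value_iff_partial_value_bound by blast
    then have 1: "absv ((?U - u) * ?V) \<le> absv z ^ N"
      unfolding absv_mult using V1 absv_nonneg by (meson mult_right_le_one_le order_trans)
    have 2: "absv (partial_value (U * V) z N) \<le> absv z ^ N"
      using assms integral_fps_mult fps_has_value_iff_partial_value_bound[of "U * V" z 0] by simp
    have 3: "absv (?U * ?V - partial_value (U * V) z N) \<le> absv z ^ N"
      using assms by (intro partial_value_mult) auto
    have "absv (?U * ?V) \<le> absv z ^ N"
      using 2 3 absv_add_le_max[of "?U * ?V - partial_value (U * V) z N" "partial_value (U * V) z N"] by simp
    then have "absv (?U * ?V - (?U - u) * ?V) \<le> absv z ^ N"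
      using 1 absv_diff_le_max[of "?U * ?V" "(?U - u) * ?V"] by linarith
    moreover have "?U * ?V - (?U - u) * ?V = ?V * u" by (simp add: algebra_simps)
    ultimately have "absv ?V * absv u \<le> absv z ^ N" by (simp add: absv_mult)
    then show ?thesis using u_pos by (simp add: le_divide_eq)
  qed
  have lim: "(\<lambda>N. absv z ^ N / absv u) \<longlonglongrightarrow> 0"
    using tendsto_divide[OF z_lim tendsto_const, of "absv u"] u_pos by simp
  have "(\<lambda>N. absv (partial_value V z N)) \<longlonglongrightarrow> 0"
    by (rule tendsto_sandwich[OF _ _ tendsto_const lim]) (use bound absv_nonneg in auto)
  then show ?thesis by (simp add: fps_has_value_def partial_value_def)
qed

text \<open>
  The coefficients of \<open>H / (X - z)\<close> are \<open>-(H\<^sub>0 + \<dots> + H\<^sub>i z\<^sup>i) / z\<^sup>i\<^sup>+\<^sup>1\<close>. Since the complete sum is zero,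
  the partial sum in the numerator is bounded by \<open>|z|\<^sup>i\<^sup>+\<^sup>1\<close>.
\<close>

lemma integral_fps_root_factor:
  assumes H: "integral_fps H" and z: "absv z < 1" "z \<noteq> 0" and root: "fps_has_value absv H z 0"
  shows "\<exists>q. integral_fps q \<and> H = (fps_X - fps_const z) * q"
proof -
  define q where "q = Abs_fps (\<lambda>i. - partial_value H z (Suc i) / z ^ Suc i)"
  have z_pos: "absv z > 0" using z(2) absv_nonneg[of z] absv_eq_0_iff[of z] by linarith
  have "absv (q $ i) \<le> 1" for i
  proof -
    have "absv (partial_value H z (Suc i)) \<le> absv z ^ Suc i"
      using root fps_has_value_iff_partial_value_bound[OF H z(1), of 0] by (metis diff_zero)
    moreover have "q $ i * z ^ Suc i = - partial_value H z (Suc i)" using z(2) by (simp add: q_def)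
    then have "absv (q $ i) * absv z ^ Suc i = absv (partial_value H z (Suc i))"
      by (metis absv_mult absv_power absv_uminus)
    ultimately have "absv (q $ i) * absv z ^ Suc i \<le> 1 * absv z ^ Suc i" by simp
    then show ?thesis using z_pos by (meson mult_le_cancel_right not_less zero_less_power)
  qed
  moreover have "H = (fps_X - fps_const z) * q"
  proof (rule fps_ext)
    fix n
    show "H $ n = ((fps_X - fps_const z) * q) $ n"
      using z(2) by (cases n) (simp_all add: q_def left_diff_distrib partial_value_def field_simps)
  qed
  ultimately show ?thesis by (auto simp: integral_fps_def)
qed

lemma integral_fps_roots_factor:
  assumes "finite Z" "integral_fps H" "\<And>z. z \<in> Z \<Longrightarrow> z \<noteq> 0 \<and> absv z < 1 \<and> fps_has_value absv H z 0"
  shows "\<exists>q. integral_fps q \<and> H = (\<Prod>z\<in>Z. fps_X - fps_const z) * q"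
  using assms
proof (induction Z arbitrary: H rule: finite_induct)
  case (insert z Z)
  then obtain q where q: "integral_fps q" "H = (fps_X - fps_const z) * q"
    using integral_fps_root_factor by (metis insertI1)
  have "z' \<noteq> 0 \<and> absv z' < 1 \<and> fps_has_value absv q z' 0" if "z' \<in> Z" for z'
  proof -
    have z': "absv z' < 1" "z' \<noteq> 0" "fps_has_value absv ((fps_X - fps_const z) * q) z' 0"
      using insert.prems(2) that q(2) by auto
    have "integral_fps (fps_const z)" using insert.prems(2) by (intro integral_fps_const) force
    then have "fps_has_value absv (fps_X - fps_const z) z' (z' - z)" "integral_fps (fps_X - fps_const z)"
      using z' by (auto intro!: fps_has_value_diff fps_has_value_X fps_has_value_const integral_fps_diff integral_fps_X)
    moreover have "z' - z \<noteq> 0" using insert.hyps(2) that by auto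
    ultimately show ?thesis using fps_has_value_0_cancel_factor[of "fps_X - fps_const z" q z'] q(1) z' by blast
  qed
  then obtain q' where "integral_fps q'" "q = (\<Prod>z\<in>Z. fps_X - fps_const z) * q'"
    using insert.IH q(1) by blast
  then show ?case using q(2) insert.hyps by (intro exI[of _ q']) (simp add: mult.assoc)
qed simp

text \<open>
  After the factors \<open>X - z\<close> have been split off, the lowest coefficient of \<open>H\<close> is the
  constant term of their product times a coefficient of the integral cofactor.
\<close>

lemma lowest_coefficient_le_prod_roots:
  assumes Z: "finite Z" "\<And>z. z \<in> Z \<Longrightarrow> z \<noteq> 0 \<and> absv z < 1 \<and> fps_has_value absv H z 0"
    and H: "integral_fps H" and low: "\<And>k. k < e \<Longrightarrow> H $ k = 0"
  shows "absv (H $ e) \<le> (\<Prod>z\<in>Z. absv z)"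
proof -
  let ?P = "\<Prod>z\<in>Z. fps_X - fps_const z"
  obtain q where q: "integral_fps q" "H = ?P * q"
    using integral_fps_roots_factor[OF Z(1) H Z(2)] by blast
  have P0: "?P $ 0 = (\<Prod>z\<in>Z. - z)" using Z(1) by (induction Z rule: finite_induct) simp_all
  then have P_nz: "?P $ 0 \<noteq> 0" using Z by auto
  have "q = inverse ?P * H" using q(2) inverse_mult_eq_1[OF P_nz] by (simp flip: mult.assoc)
  then have "q $ e = (\<Sum>i\<in>{0..e}. inverse ?P $ i * H $ (e - i))" by (simp add: fps_mult_nth)
  also have "\<dots> = (\<Sum>i\<in>{0}. inverse ?P $ i * H $ (e - i))"
    by (rule sum.mono_neutral_right) (auto intro!: low)
  finally have "H $ e = ?P $ 0 * q $ e" using P_nz by simp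
  then have "absv (H $ e) = (\<Prod>z\<in>Z. absv z) * absv (q $ e)"
    using absv_prod[of "\<lambda>z. - z" Z] by (simp only: P0 absv_mult absv_uminus)
  also have "\<dots> \<le> (\<Prod>z\<in>Z. absv z)"
    using q(1) absv_nonneg by (intro mult_right_le_one_le prod_nonneg) (auto simp: integral_fps_def)
  finally show ?thesis .
qed

end

section \<open>Periodic points\<close>

lemma funpow_periodic_mult:
  assumes "(g ^^ r) x = x"
  shows "(g ^^ (r * k)) x = x"
proof (induction k)
  case (Suc k)
  have "(g ^^ (r * Suc k)) x = (g ^^ (r * k)) ((g ^^ r) x)"
    by (metis add.commute comp_apply funpow_add mult_Suc_right)
  then show ?case using Suc assms by simp
qed simp

text \<open>
  The return times of \<open>x\<close> are closed under greatest common divisors. So a return time that is not a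
  multiple of \<open>p\<^sup>n\<^sup>+\<^sup>1\<close> would make \<open>p\<^sup>n\<close> one.
\<close>

lemma funpow_prime_power_period:
  assumes "prime p" and period: "(g ^^ p ^ Suc n) x = x" and not_period: "(g ^^ p ^ n) x \<noteq> x"
  shows "inj_on (\<lambda>i. (g ^^ i) x) {..<p ^ Suc n}"
    and "i \<le> p ^ Suc n \<Longrightarrow> (g ^^ (p ^ n)) ((g ^^ i) x) \<noteq> (g ^^ i) x"
proof -
  have dvd: "p ^ Suc n dvd r" if r: "(g ^^ r) x = x" for r
  proof -
    define d where "d = gcd (p ^ Suc n) r"
    have "p ^ Suc n \<noteq> 0" using assms(1) by (simp add: prime_gt_0_nat)
    then obtain u v where uv: "p ^ Suc n * u = r * v + d"
      using bezout_nat unfolding d_def by blast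
    have "(g ^^ d) x = (g ^^ d) ((g ^^ (r * v)) x)" using funpow_periodic_mult[OF r] by simp
    also have "\<dots> = (g ^^ (p ^ Suc n * u)) x" unfolding uv by (simp add: funpow_add add.commute[of "r * v"])
    also have "\<dots> = x" using funpow_periodic_mult[OF period] by simp
    finally have dx: "(g ^^ d) x = x" .
    have "d dvd p ^ Suc n" by (simp add: d_def)
    then obtain l where l: "l \<le> Suc n" "d = p ^ l" using divides_primepow_nat[OF assms(1)] by blast
    have "l = Suc n"
    proof (rule ccontr)
      assume "l \<noteq> Suc n"
      then have "p ^ n = d * p ^ (n - l)" using l by (simp flip: power_add)
      then show False using funpow_periodic_mult[OF dx, of "p ^ (n - l)"] not_period by simp
    qed
    then show ?thesis using l(2) unfolding d_def by (metis gcd_dvd2)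
  qed
  have return: "(g ^^ r) x = x" if "(g ^^ (r + i)) x = (g ^^ i) x" "i \<le> p ^ Suc n" for r i
  proof -
    define k where "k = p ^ Suc n - i"
    have k: "k + i = p ^ Suc n" using that(2) by (simp add: k_def)
    have "(g ^^ r) x = (g ^^ r) ((g ^^ (k + i)) x)" unfolding k period ..
    also have "\<dots> = (g ^^ k) ((g ^^ (r + i)) x)" by (metis add.left_commute comp_apply funpow_add)
    also have "\<dots> = (g ^^ (k + i)) x" unfolding that(1) by (simp add: funpow_add)
    finally show ?thesis unfolding k period .
  qed
  have "i = j" if "i < p ^ Suc n" "j < p ^ Suc n" "(g ^^ i) x = (g ^^ j) x" "i \<le> j" for i j
  proof -
    have "(g ^^ (j - i)) x = x" using return[of "j - i" i] that by simp
    then have "p ^ Suc n dvd j - i" by (rule dvd)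
    then show ?thesis using that by (metis dvd_imp_le diff_is_0_eq le_antisym less_imp_diff_less not_gr_zero not_le)
  qed
  then show "inj_on (\<lambda>i. (g ^^ i) x) {..<p ^ Suc n}"
    by (intro inj_onI) (metis lessThan_iff linear)
  show "(g ^^ (p ^ n)) ((g ^^ i) x) \<noteq> (g ^^ i) x" if "i \<le> p ^ Suc n"
    using return[of "p ^ n" i] that not_period by (auto simp: funpow_add)
qed

context ultrametric_field
begin

lemma fps_has_value_iterate:
  assumes "integral_fps f" "f $ 0 = 0"
    and "\<And>i. absv (x i) < 1" "\<And>i. fps_has_value absv f (x i) (x (Suc i))"
  shows "fps_has_value absv (fps_iterate f n) (x i) (x (n + i))"
proof (induction n arbitrary: i)
  case 0
  then show ?case using fps_has_value_X by simp
next
  case (Suc n)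
  then show ?case
    using fps_has_value_compose[of "fps_iterate f n" f "x i" "x (Suc i)"] assms Suc[of "Suc i"]
      integral_fps_iterate by simp
qed

lemma periodic_point_orbit:
  assumes f: "integral_fps f" "f $ 0 = 0" and z: "absv z < 1" and periodic: "fps_periodic_point absv f z"
  shows "fps_has_value absv (fps_iterate f n) ((fps_value absv f ^^ i) z) ((fps_value absv f ^^ (n + i)) z)"
    and "absv ((fps_value absv f ^^ i) z) \<le> absv z"
proof -
  define x where "x i = (fps_value absv f ^^ i) z" for i
  obtain m where m: "m \<ge> 1" "\<And>i. i < m \<Longrightarrow> fps_converges_at absv f (x i)" "x m = z"
    using periodic unfolding fps_periodic_point_def x_def by blast
  have mod: "x i = x (i mod m)" for i
    unfolding x_def using m(3) funpow_mod_eq[of m "fps_value absv f" z i] unfolding x_def by simp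
  have conv: "fps_converges_at absv f (x i)" for i
    unfolding mod[of i] using m(1) by (intro m(2)) simp
  have step: "fps_has_value absv f (x i) (x (Suc i))" for i
  proof -
    obtain s where "fps_has_value absv f (x i) s" using conv unfolding fps_converges_at_def by blast
    then show ?thesis using fps_value_eqI[of f "x i" s] by (simp add: x_def)
  qed
  have bound: "absv (x i) \<le> absv z" for i
  proof (induction i)
    case (Suc i)
    then have "absv (x (Suc i)) \<le> absv (x i)" using absv_fps_value_le f step z by (meson le_less_trans)
    then show ?case using Suc by simp
  qed (simp add: x_def)
  show "absv ((fps_value absv f ^^ i) z) \<le> absv z" using bound by (simp add: x_def)
  show "fps_has_value absv (fps_iterate f n) ((fps_value absv f ^^ i) z) ((fps_value absv f ^^ (n + i)) z)"
    using fps_has_value_iterate[where x = x, OF f _ step, of n i] bound z unfolding x_def by (metis le_less_trans)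
qed

text \<open>
  If \<open>G\<close> moved \<open>z\<close>, then \<open>z\<close> would be a zero of \<open>(G\<^sup>t - X) / (G - X)\<close>. But the constant
  term of this series has absolute value \<open>1\<close>, so it has no zeros in the open unit disk.
\<close>

lemma fixed_point_of_iterate_coprime_char:
  assumes G: "integral_fps G" "tangent_to_id 1 G" and t: "prime p" "CHAR('a) = p" "\<not> p dvd t"
    and z: "absv z < 1" "z \<noteq> 0"
    and w: "fps_has_value absv G z w" and fixed: "fps_has_value absv (fps_iterate G t) z z"
  shows "w = z"
proof (rule ccontr)
  assume "w \<noteq> z"
  obtain Q where Q: "integral_fps Q" "fps_iterate G t - fps_X = (G - fps_X) * Q" "Q $ 0 = of_nat t"
    using iterate_minus_id_factor[OF G] by blast
  have int: "integral_fps (G - fps_X)" using G(1) by (intro integral_fps_diff integral_fps_X)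
  have "fps_has_value absv (G - fps_X) z (w - z)"
    using G(1) z(1) w by (intro fps_has_value_diff fps_has_value_X integral_fps_X)
  moreover have "fps_has_value absv ((G - fps_X) * Q) z (z - z)"
    unfolding Q(2)[symmetric] using G(1) z(1) fixed
    by (intro fps_has_value_diff fps_has_value_X integral_fps_X integral_fps_iterate)
  ultimately have "fps_has_value absv Q z 0"
    using fps_has_value_0_cancel_factor[OF int Q(1) z(1), of "w - z"] \<open>w \<noteq> z\<close> by simp
  then have "absv (Q $ 0) \<le> (\<Prod>z\<in>{z}. absv z)"
    using z Q(1) by (intro lowest_coefficient_le_prod_roots) auto
  then show False using z(1) absv_of_nat_coprime_char[OF t] Q(3) by simp
qed

text \<open>
  Writing a period as \<open>p\<^sup>s t\<close> with \<open>t\<close> prime to \<open>p\<close>, the factor \<open>t\<close> can be removed. The least \<open>s\<close> that occurs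
  gives the minimal period.
\<close>

lemma minimal_period_prime_power:
  assumes f: "integral_fps f" "tangent_to_id 1 f" and p: "prime p" "CHAR('a) = p"
    and z: "absv z < 1" "z \<noteq> 0" and periodic: "fps_periodic_point absv f z"
  shows "\<exists>s. (fps_value absv f ^^ p ^ s) z = z"
proof -
  let ?g = "fps_value absv f"
  have f0: "f $ 0 = 0" using f(2) by (rule tangent_to_id_nth_0)
  obtain m where m: "m \<ge> 1" "(?g ^^ m) z = z" using periodic unfolding fps_periodic_point_def by blast
  obtain t where t: "m = p ^ multiplicity p m * t" "\<not> p dvd t"
    using multiplicity_decompose'[of m p] m(1) p(1) by (metis not_one_le_zero not_prime_unit)
  define q where "q = p ^ multiplicity p m"
  have val: "fps_has_value absv (fps_iterate f n) z ((?g ^^ n) z)" for n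
    using periodic_point_orbit(1)[OF f(1) f0 z(1) periodic, of n 0] by simp
  have "fps_has_value absv (fps_iterate (fps_iterate f q) t) z z"
    using val[of "q * t"] m(2) t(1) fps_iterate_mult[OF f0, of q t] by (simp add: q_def)
  then have "(?g ^^ q) z = z"
    using fixed_point_of_iterate_coprime_char[OF _ _ p t(2) z val] f
    by (simp add: integral_fps_iterate tangent_to_id_iterate)
  then show ?thesis by (auto simp: q_def)
qed

lemma fixed_point_bound:
  assumes f: "integral_fps f" "tangent_to_id 2 f" and z: "absv z < 1" "z \<noteq> 0" "fps_has_value absv f z z"
  shows "absv (f $ 3) \<le> absv z"
proof -
  have "fps_has_value absv (f - fps_X) z (z - z)"
    using f(1) z by (intro fps_has_value_diff fps_has_value_X integral_fps_X)
  then have "absv ((f - fps_X) $ 3) \<le> (\<Prod>z\<in>{z}. absv z)"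
    using f z by (intro lowest_coefficient_le_prod_roots integral_fps_diff integral_fps_X)
      (auto simp: tangent_to_id_def)
  then show ?thesis by simp
qed

text \<open>
  The lowest coefficient of the quotient \<open>h = (F - X) / (G - X)\<close> is computed from the leading
  coefficients of the iterates \<open>F\<close> and \<open>G\<close>, and estimated through the zeros of \<open>h\<close>
  along the orbit. The exponents \<open>p\<^sup>n\<^sup>+\<^sup>1\<close> of \<open>|z|\<close> and \<open>p\<^sup>n\<close> of \<open>\<lambda>\<close> leave the same bound
  \<open>|\<lambda>| \<le> |z|\<^sup>p\<close> for every \<open>n\<close>.
\<close>

lemma periodic_point_bound:
  fixes f :: "'a fps" and p :: nat
  defines "lam \<equiv> (f $ 3) ^ (p - 3) * (3 / 2 * (f $ 3) ^ 3 + (f $ 4) ^ 2 - f $ 3 * f $ 5)"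
  assumes p: "prime p" "p \<ge> 3" "CHAR('a) = p"
    and f: "integral_fps f" "tangent_to_id 2 f" and a: "f $ 3 \<noteq> 0" and lam: "lam \<noteq> 0"
    and z: "absv z < 1" and periodic: "fps_periodic_point absv f z"
    and not_fixed: "fps_value absv f z \<noteq> z"
  shows "absv lam \<le> absv z ^ p"
proof -
  let ?g = "fps_value absv f"
  have f0: "f $ 0 = 0" and f1: "tangent_to_id 1 f" using f(2) by (auto simp: tangent_to_id_def)
  have val: "fps_has_value absv (fps_iterate f n) ((?g ^^ i) z) ((?g ^^ (n + i)) z)" for n i
    by (rule periodic_point_orbit(1)[OF f(1) f0 z periodic])
  have bound: "absv ((?g ^^ i) z) \<le> absv z" for i
    by (rule periodic_point_orbit(2)[OF f(1) f0 z periodic])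
  have z_nz: "z \<noteq> 0"
    using bound[of 1] not_fixed absv_nonneg[of "?g z"] absv_eq_0_iff[of "?g z"] by auto
  have "\<exists>s. (?g ^^ p ^ s) z = z"
    by (rule minimal_period_prime_power[OF f(1) f1 p(1,3) z z_nz periodic])
  define s where "s = (LEAST s. (?g ^^ p ^ s) z = z)"
  have s: "(?g ^^ p ^ s) z = z" unfolding s_def by (rule LeastI_ex) fact
  have "s \<noteq> 0" using s not_fixed by (intro notI) simp
  then obtain n where n: "s = Suc n" by (cases s) auto
  have not_n: "(?g ^^ p ^ n) z \<noteq> z" using n not_less_Least[of n "\<lambda>s. (?g ^^ p ^ s) z = z"] by (simp flip: s_def)
  note orbit = funpow_prime_power_period[OF p(1) s[unfolded n] not_n]
  define N where "N = p ^ Suc n"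
  define G where "G = fps_iterate f (p ^ n)"
  define F where "F = fps_iterate f N"
  have int: "integral_fps G" "integral_fps F" using f(1) by (simp_all add: G_def F_def integral_fps_iterate)
  have "F = fps_iterate G p"
    unfolding F_def G_def N_def using fps_iterate_mult[OF f0, of "p ^ n" p] by (simp add: mult.commute)
  then obtain h where h: "integral_fps h" "F - fps_X = (G - fps_X) * h"
    using iterate_minus_id_factor[OF int(1)] tangent_to_id_iterate[OF f1] unfolding G_def by blast
  have root: "fps_has_value absv h ((?g ^^ i) z) 0" if "i < N" for i
  proof -
    let ?x = "(?g ^^ i) z"
    have x: "absv ?x < 1" using bound[of i] z by simp
    have "fps_has_value absv (G - fps_X) ?x ((?g ^^ (p ^ n + i)) z - ?x)"
      unfolding G_def using val x f(1) by (intro fps_has_value_diff fps_has_value_X integral_fps_X integral_fps_iterate)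
    moreover have "(?g ^^ (p ^ n + i)) z - ?x \<noteq> 0"
      using orbit(2)[of i] that by (simp add: funpow_add N_def)
    moreover have "(?g ^^ (N + i)) z = ?x"
      using s n by (metis N_def add.commute comp_apply funpow_add)
    then have "fps_has_value absv ((G - fps_X) * h) ?x (?x - ?x)"
      unfolding h(2)[symmetric] F_def using val[of N i] x f(1)
      by (intro fps_has_value_diff fps_has_value_X integral_fps_X integral_fps_iterate) simp_all
    ultimately show ?thesis
      using fps_has_value_0_cancel_factor[of "G - fps_X" h ?x] int(1) h(1) x by (simp add: integral_fps_diff integral_fps_X)
  qed
  define d where "d n = 2 * (\<Sum>i\<le>n. p ^ i)" for n
  define L where "L n = lam ^ (\<Sum>i<n. p ^ i)" for n
  have lead: "tangent_to_id (d k) (fps_iterate f (p ^ k)) \<and> fps_iterate f (p ^ k) $ (d k + 1) = f $ 3 * L k" for k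
    using prime_power_iterate_leading_coefficient[OF p f(2) a, of k] lam unfolding lam_def d_def L_def by blast
  have L_nz: "L k \<noteq> 0" for k using lam by (simp add: L_def)
  have sub: "subdegree (fps_iterate f (p ^ k) - fps_X) = d k + 1"
    "(fps_iterate f (p ^ k) - fps_X) $ (d k + 1) = f $ 3 * L k" for k
  proof -
    have "d k \<ge> 2" using p(2) by (simp add: d_def sum.atMost_shift)
    then show lc: "(fps_iterate f (p ^ k) - fps_X) $ (d k + 1) = f $ 3 * L k" using lead by simp
    show "subdegree (fps_iterate f (p ^ k) - fps_X) = d k + 1"
    proof (rule subdegreeI)
      show "(fps_iterate f (p ^ k) - fps_X) $ (d k + 1) \<noteq> 0" unfolding lc using a L_nz by simp
    qed (use lead[of k] in \<open>simp add: tangent_to_id_def\<close>)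
  qed
  have "F - fps_X \<noteq> 0" using sub[of "Suc n"] a L_nz unfolding F_def N_def by force
  then have "G - fps_X \<noteq> 0" "h \<noteq> 0" using h(2) by auto
  then have "(F - fps_X) $ subdegree (F - fps_X) = (G - fps_X) $ subdegree (G - fps_X) * h $ subdegree h"
    unfolding h(2) by (simp only: subdegree_mult nth_subdegree_mult not_False_eq_True)
  then have "f $ 3 * L (Suc n) = f $ 3 * L n * h $ subdegree h"
    unfolding F_def G_def N_def sub .
  moreover have "L (Suc n) = L n * lam ^ (p ^ n)" by (simp add: L_def power_add)
  ultimately have lowest: "h $ subdegree h = lam ^ (p ^ n)" using a L_nz by simp
  let ?Z = "(\<lambda>i. (?g ^^ i) z) ` {..<N}"
  \<comment> \<open>The orbit avoids \<open>0\<close>, since \<open>0\<close> is fixed and the orbit returns to \<open>z \<noteq> 0\<close>.\<close>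
  have "x \<noteq> 0" if orbit_point: "x \<in> ?Z" for x
  proof
    assume "x = 0"
    then obtain i where i: "i < N" "(?g ^^ i) z = 0" using orbit_point by auto
    have "fps_has_value absv (fps_iterate f (N - i)) 0 z"
      using val[of "N - i" i] i s n by (simp add: N_def)
    then have "absv z \<le> absv 0"
      using absv_fps_value_le integral_fps_iterate[OF f(1)] fps_iterate_nth_0[OF f0] by (metis absv_0 zero_less_one)
    then show False using z_nz absv_nonneg[of z] absv_eq_0_iff[of z] by simp
  qed
  then have "absv (h $ subdegree h) \<le> (\<Prod>x\<in>?Z. absv x)"
    using root bound z h(1) by (intro lowest_coefficient_le_prod_roots) (auto intro: le_less_trans)
  also have "\<dots> \<le> (\<Prod>x\<in>?Z. absv z)" using bound absv_nonneg by (intro prod_mono) auto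
  also have "\<dots> = absv z ^ N" using orbit(1) by (simp add: card_image N_def)
  finally have "absv lam ^ (p ^ n) \<le> (absv z ^ p) ^ (p ^ n)"
    unfolding lowest absv_power N_def by (simp add: mult.commute flip: power_mult)
  moreover have "p ^ n = Suc (p ^ n - 1)" using p(1) by (simp add: prime_gt_0_nat)
  ultimately show ?thesis using power_le_imp_le_base[of "absv lam" "p ^ n - 1" "absv z ^ p"] absv_nonneg by simp
qed

end

theorem theoremA:
  fixes absv :: "'k::field \<Rightarrow> real"
    and p :: nat
    and a :: "nat \<Rightarrow> 'k"
    and f :: "'k fps"
    and lam \<zeta>\<^sub>0 :: 'k
  assumes "prime p" and "p \<ge> 5"
    and "ultrametric_field absv" and "CHAR('k) = p"
    and "f = fps_X * (1 + Abs_fps (\<lambda>j. if j \<ge> 2 then a j else 0))"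
    and "\<And>n. absv (fps_nth f n) \<le> 1"
    and "lam = a 2 ^ (p - 3) * (3 / 2 * a 2 ^ 3 + a 3 ^ 2 - a 2 * a 4)"
    and "absv \<zeta>\<^sub>0 < 1"
    and "fps_periodic_point absv f \<zeta>\<^sub>0"
  shows "(\<not> fps_fixed_point absv f \<zeta>\<^sub>0 \<longrightarrow> absv \<zeta>\<^sub>0 \<ge> absv lam powr (1 / real p)) \<and>
         (fps_fixed_point absv f \<zeta>\<^sub>0 \<and> \<zeta>\<^sub>0 \<noteq> 0 \<longrightarrow> absv \<zeta>\<^sub>0 \<ge> absv (a 2))"
proof -
  interpret ultrametric_field absv by fact
  have f: "integral_fps f" using assms(6) by (simp add: integral_fps_def)
  have coeff: "f $ 0 = 0" "f $ 1 = 1" "f $ 2 = 0" "f $ 3 = a 2" "f $ 4 = a 3" "f $ 5 = a 4"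
    by (simp_all add: assms(5))
  have "k = 0 \<or> k = 1 \<or> k = 2" if "k \<le> 2" for k :: nat using that by auto
  then have tang: "tangent_to_id 2 f" using coeff unfolding tangent_to_id_def by (auto simp: fps_X_def)
  show ?thesis
  proof (intro conjI impI)
    assume not_fixed: "\<not> fps_fixed_point absv f \<zeta>\<^sub>0"
    have "fps_converges_at absv f ((fps_value absv f ^^ 0) \<zeta>\<^sub>0)"
      using assms(9) unfolding fps_periodic_point_def by force
    then have moved: "fps_value absv f \<zeta>\<^sub>0 \<noteq> \<zeta>\<^sub>0" using not_fixed by (simp add: fps_fixed_point_def)
    show "absv lam powr (1 / real p) \<le> absv \<zeta>\<^sub>0"
    proof (cases "lam = 0")
      case True
      then show ?thesis using absv_nonneg by simp
    next
      case False
      then have "a 2 \<noteq> 0" using assms(1,2,7)  by auto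
      then have "absv lam \<le> absv \<zeta>\<^sub>0 ^ p"
        using periodic_point_bound[OF assms(1) _ assms(4) f tang _ _ assms(8,9) moved] assms(2,7) False coeff by simp
      then have "absv lam powr (1 / real p) \<le> (absv \<zeta>\<^sub>0 ^ p) powr (1 / real p)"
        using absv_nonneg by (intro powr_mono2) simp_all
      also have "\<dots> = absv \<zeta>\<^sub>0"
        using assms(2) absv_nonneg[of \<zeta>\<^sub>0] by (cases "absv \<zeta>\<^sub>0 = 0") (simp_all add: powr_powr flip: powr_realpow)
      finally show ?thesis .
    qed
  next
    assume fixed: "fps_fixed_point absv f \<zeta>\<^sub>0 \<and> \<zeta>\<^sub>0 \<noteq> 0"
    then have "fps_has_value absv f \<zeta>\<^sub>0 \<zeta>\<^sub>0"
      unfolding fps_fixed_point_def fps_converges_at_def using fps_value_eqI by auto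
    then show "absv (a 2) \<le> absv \<zeta>\<^sub>0"
      using fixed_point_bound[OF f tang assms(8)] fixed coeff(4) by simp
  qed
qed

end
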